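(* Let $A$ be a nilpotent anticommutative algebra over $\mathbb{Q}$ of nilpotency class $\ge2$. Let $Q(A)$ be the loop obtained from $A$ by the operation $$a\circ b=a+b+kab+lba+ma^2+nb^2+\cdots,$$ where $k,l,m,n\in\mathbb{Q}$, $k\ne l$, and the dots stand for a fixed linear combination over $\mathbb{Q}$ of nonassociative monomials in $a,b$ of degree $\ge3$. Then $Q(A)$ is a uniquely divisible nilpotent loop. The original operations $a+b$ and $ab$ of $A$ can be uniquely reconstructed as derived operations from the operation $\circ$ alone.
   Context: An algebra is a vector space with a bilinear multiplication; it is anticommutative if $x^2=0$ for all $x$. It is nilpotent of class $c$ if every product (with any bracketing) of $c+1$ elements is zero while some product of $c$ elements is nonzero. A quasigroup is a set with a binary operation such that $a\circ y=c$ and $x\circ b=c$ have unique solutions; a loop is a quasigroup with a neutral element. For anticommutative nilpotent $A$, $Q(A)$ (the set $A$ with $\circ$) is a loop with neutral element $0$, and it is power-associative: every element lies in a subgroup with the same neutral element, so powers $a^n$, $n\in\mathbb{Z}$, make sense. A power-associative loop $L$ is uniquely divisible if for any $a\in L$ and natural $n\ge1$ there is a unique $x\in L$ with $x^n=a$; then $a^{q}$ is defined for $q=s/t\in\mathbb{Q}$ as the unique solution $x$ of $x^t=a^s$. A loop is nilpotent if it has a finite ascending central series of normal subloops, where the center of a loop consists of the elements that commute with all elements and associate (in every position) with all pairs of elements. "Derived from $\circ$ alone" means: given by a term built from $\circ$ and the operations $a\mapsto a^q$ ($q\in\mathbb{Q}$), the latter being determined by the loop structure itself, since for $q=s/t$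 (with $s\in\mathbb{Z}$ and $t\ge1$ a natural number) the element $a^q$ is the unique solution $x$ in the loop $Q(A)$ of the equation $x^t=a^s$. *)

theory Defs
  imports Complex_Main "HOL-Algebra.Module" "HOL-Algebra.Coset"
begin

section \<open>Nonassociative algebras over the rationals\<close>

definition rat_field :: "rat ring" where
  "rat_field = \<lparr>carrier = UNIV, mult = (*), one = 1, zero = 0, add = (+)\<rparr>"

text \<open>The product of the algebra is the \<open>mult\<close> field of the module record.  It is not assumed
  associative, commutative or unital; the \<open>one\<close> field of the record plays no role.\<close>

locale rat_algebra = module rat_field A for A (structure) +
  assumes prod_closed: "\<lbrakk>x \<in> carrier A; y \<in> carrier A\<rbrakk> \<Longrightarrow> x \<otimes> y \<in> carrier A"
    and prod_add_left: "\<lbrakk>x \<in> carrier A; y \<in> carrier A; z \<in> carrier A\<rbrakk> \<Longrightarrow>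
      (x \<oplus> y) \<otimes> z = (x \<otimes> z) \<oplus> (y \<otimes> z)"
    and prod_add_right: "\<lbrakk>x \<in> carrier A; y \<in> carrier A; z \<in> carrier A\<rbrakk> \<Longrightarrow>
      z \<otimes> (x \<oplus> y) = (z \<otimes> x) \<oplus> (z \<otimes> y)"
    and prod_smult_left: "\<lbrakk>x \<in> carrier A; y \<in> carrier A\<rbrakk> \<Longrightarrow> (q \<odot> x) \<otimes> y = q \<odot> (x \<otimes> y)"
    and prod_smult_right: "\<lbrakk>x \<in> carrier A; y \<in> carrier A\<rbrakk> \<Longrightarrow> x \<otimes> (q \<odot> y) = q \<odot> (x \<otimes> y)"

locale anticommutative_rat_algebra = rat_algebra +
  assumes prod_square: "x \<in> carrier A \<Longrightarrow> x \<otimes> x = \<zero>"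

datatype (letters: 'v) monomial =
    Letter 'v
  | Prod "'v monomial" "'v monomial"

primrec monomial_degree :: "'v monomial \<Rightarrow> nat" where
  "monomial_degree (Letter v) = 1"
| "monomial_degree (Prod s t) = monomial_degree s + monomial_degree t"

primrec eval_monomial :: "('b, 'm) monoid_scheme \<Rightarrow> ('v \<Rightarrow> 'b) \<Rightarrow> 'v monomial \<Rightarrow> 'b" where
  "eval_monomial A \<rho> (Letter v) = \<rho> v"
| "eval_monomial A \<rho> (Prod s t) = eval_monomial A \<rho> s \<otimes>\<^bsub>A\<^esub> eval_monomial A \<rho> t"

text \<open>A bracketed product of algebra elements is a monomial whose letters are these elements,
  evaluated under \<open>id\<close>.\<close>

definition nilpotent_of_class :: "('b, 'm) ring_scheme \<Rightarrow> nat \<Rightarrow> bool" where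
  "nilpotent_of_class A c \<longleftrightarrow>
     (\<forall>t. letters t \<subseteq> carrier A \<and> monomial_degree t = c + 1 \<longrightarrow> eval_monomial A id t = \<zero>\<^bsub>A\<^esub>) \<and>
     (\<exists>t. letters t \<subseteq> carrier A \<and> monomial_degree t = c \<and> eval_monomial A id t \<noteq> \<zero>\<^bsub>A\<^esub>)"


section \<open>Loops\<close>

locale quasigroup =
  fixes L (structure)
  assumes closed: "\<lbrakk>x \<in> carrier L; y \<in> carrier L\<rbrakk> \<Longrightarrow> x \<otimes> y \<in> carrier L"
    and left_div: "\<lbrakk>a \<in> carrier L; c \<in> carrier L\<rbrakk> \<Longrightarrow> \<exists>!y. y \<in> carrier L \<and> a \<otimes> y = c"
    and right_div: "\<lbrakk>b \<in> carrier L; c \<in> carrier L\<rbrakk> \<Longrightarrow> \<exists>!x. x \<in> carrier L \<and> x \<otimes> b = c"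

locale loop = quasigroup +
  assumes neutral_closed: "\<one> \<in> carrier L"
    and neutral_left: "x \<in> carrier L \<Longrightarrow> \<one> \<otimes> x = x"
    and neutral_right: "x \<in> carrier L \<Longrightarrow> x \<otimes> \<one> = x"

text \<open>The record update keeps the field \<open>one\<close>, so the subgroup has the neutral element of the loop.\<close>

locale power_associative_loop = loop +
  assumes power_assoc: "a \<in> carrier L \<Longrightarrow>
    \<exists>H \<subseteq> carrier L. a \<in> H \<and> group (L\<lparr>carrier := H\<rparr>)"

text \<open>Powers are those of \<open>HOL-Algebra.Group\<close>.  In a power-associative loop they agree with the
  powers computed in any subgroup as above, as \<open>inv a\<close> is determined by \<open>a \<otimes> inv a = \<one>\<close>.\<close>

locale uniquely_divisible_loop = power_associative_loop +
  assumes unique_root: "\<lbrakk>a \<in> carrier L; (n::nat) \<ge> 1\<rbrakk> \<Longrightarrow> \<exists>!x. x \<in> carrier L \<and> x [^] n = a"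

definition rat_pow :: "('a, 'm) monoid_scheme \<Rightarrow> 'a \<Rightarrow> rat \<Rightarrow> 'a" where
  "rat_pow L a q = (THE x. x \<in> carrier L \<and>
     (\<forall>(s::int) (t::nat). t \<ge> 1 \<and> q = of_int s / of_nat t \<longrightarrow> x [^]\<^bsub>L\<^esub> t = a [^]\<^bsub>L\<^esub> s))"

definition loop_center :: "('a, 'm) monoid_scheme \<Rightarrow> 'a set" where
  "loop_center L = {z \<in> carrier L.
     (\<forall>x \<in> carrier L. z \<otimes>\<^bsub>L\<^esub> x = x \<otimes>\<^bsub>L\<^esub> z) \<and>
     (\<forall>x \<in> carrier L. \<forall>y \<in> carrier L.
        (z \<otimes>\<^bsub>L\<^esub> x) \<otimes>\<^bsub>L\<^esub> y = z \<otimes>\<^bsub>L\<^esub> (x \<otimes>\<^bsub>L\<^esub> y) \<and>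
        (x \<otimes>\<^bsub>L\<^esub> z) \<otimes>\<^bsub>L\<^esub> y = x \<otimes>\<^bsub>L\<^esub> (z \<otimes>\<^bsub>L\<^esub> y) \<and>
        (x \<otimes>\<^bsub>L\<^esub> y) \<otimes>\<^bsub>L\<^esub> z = x \<otimes>\<^bsub>L\<^esub> (y \<otimes>\<^bsub>L\<^esub> z))}"

text \<open>The standard (Bruck) notion of a normal subloop; \<open>L Mod N\<close> is then the quotient loop.\<close>

definition normal_subloop :: "'a set \<Rightarrow> ('a, 'm) monoid_scheme \<Rightarrow> bool" where
  "normal_subloop N L \<longleftrightarrow>
     N \<subseteq> carrier L \<and> loop (L\<lparr>carrier := N\<rparr>) \<and>
     (\<forall>x \<in> carrier L. x <#\<^bsub>L\<^esub> N = N #>\<^bsub>L\<^esub> x) \<and>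
     (\<forall>x \<in> carrier L. \<forall>y \<in> carrier L.
        (N #>\<^bsub>L\<^esub> x) #>\<^bsub>L\<^esub> y = N #>\<^bsub>L\<^esub> (x \<otimes>\<^bsub>L\<^esub> y) \<and>
        x <#\<^bsub>L\<^esub> (y <#\<^bsub>L\<^esub> N) = (x \<otimes>\<^bsub>L\<^esub> y) <#\<^bsub>L\<^esub> N)"

locale nilpotent_loop = loop +
  assumes central_series: "\<exists>(n::nat) (N :: nat \<Rightarrow> 'a set).
    N 0 = {\<one>} \<and> N n = carrier L \<and>
    (\<forall>i \<le> n. normal_subloop (N i) L) \<and>
    (\<forall>i < n. N i \<subseteq> N (Suc i) \<and> (\<forall>x \<in> N (Suc i). N i #> x \<in> loop_center (L Mod N i)))"


section \<open>Terms in two variables\<close>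

datatype var = X | Y

primrec assign :: "'a \<Rightarrow> 'a \<Rightarrow> var \<Rightarrow> 'a" where
  "assign a b X = a"
| "assign a b Y = b"

datatype loop_term =
    Var var
  | Op loop_term loop_term
  | Pow loop_term rat

primrec eval_term :: "('a, 'm) monoid_scheme \<Rightarrow> (var \<Rightarrow> 'a) \<Rightarrow> loop_term \<Rightarrow> 'a" where
  "eval_term L \<rho> (Var v) = \<rho> v"
| "eval_term L \<rho> (Op s t) = eval_term L \<rho> s \<otimes>\<^bsub>L\<^esub> eval_term L \<rho> t"
| "eval_term L \<rho> (Pow t q) = rat_pow L (eval_term L \<rho> t) q"


section \<open>The loop of an algebra\<close>

text \<open>\<open>f\<close> is the family of coefficients of the monomials of degree at least 3; it is required to
  have finite support wherever it is used.\<close>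

definition circ ::
  "(rat, 'a) module \<Rightarrow> rat \<Rightarrow> rat \<Rightarrow> rat \<Rightarrow> rat \<Rightarrow> (var monomial \<Rightarrow> rat) \<Rightarrow> 'a \<Rightarrow> 'a \<Rightarrow> 'a" where
  "circ A k l m n f a b =
     a \<oplus>\<^bsub>A\<^esub> b \<oplus>\<^bsub>A\<^esub> k \<odot>\<^bsub>A\<^esub> (a \<otimes>\<^bsub>A\<^esub> b) \<oplus>\<^bsub>A\<^esub> l \<odot>\<^bsub>A\<^esub> (b \<otimes>\<^bsub>A\<^esub> a)
       \<oplus>\<^bsub>A\<^esub> m \<odot>\<^bsub>A\<^esub> (a \<otimes>\<^bsub>A\<^esub> a) \<oplus>\<^bsub>A\<^esub> n \<odot>\<^bsub>A\<^esub> (b \<otimes>\<^bsub>A\<^esub> b)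
       \<oplus>\<^bsub>A\<^esub> (\<Oplus>\<^bsub>A\<^esub>t \<in> {t. f t \<noteq> 0}. f t \<odot>\<^bsub>A\<^esub> eval_monomial A (assign a b) t)"

definition loop_of ::
  "(rat, 'a) module \<Rightarrow> rat \<Rightarrow> rat \<Rightarrow> rat \<Rightarrow> rat \<Rightarrow> (var monomial \<Rightarrow> rat) \<Rightarrow> 'a monoid" where
  "loop_of A k l m n f = \<lparr>carrier = carrier A, mult = circ A k l m n f, one = \<zero>\<^bsub>A\<^esub>\<rparr>"

end

theory Submission
  imports Defs
begin

text \<open>Write \<open>a \<circ> b = a + b + corr a b\<close>.  Every monomial of degree at least 2 in multiples of a single
  element vanishes, so loop powers are scalar multiples.  In the ascending annihilator series
  \<open>corr\<close> lowers the level of a change in its arguments, so the equations \<open>a \<circ> y = z\<close> and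
  \<open>x \<circ> b = z\<close> are solved by successive approximation, and the series is a central series of the
  loop.

  For the reconstruction, filter the algebra generated by two elements by degree.
  If \<open>u\<close>, \<open>v\<close> have degrees at least \<open>d\<close>, \<open>e\<close>, then the
  \<open>1 / (2(k - l))\<close>-th power of \<open>(u \<circ> v) \<circ> (v \<circ> u)\<^sup>-\<^sup>1\<close> is \<open>uv\<close> modulo degree \<open>d + e + 1\<close>; hence every
  element of degree at least \<open>d\<close> is the value of a loop term modulo degree \<open>d + 1\<close>.  As
  \<open>t \<circ> s = t + s\<close> modulo degree \<open>d + 1\<close> when \<open>s\<close> has degree \<open>d\<close>, the errors can be corrected degree by
  degree, and nilpotency stops the process.\<close>

section \<open>Congruences in algebras\<close>

lemma rat_field_simps [simp]:
  "carrier rat_field = UNIV" "x \<otimes>\<^bsub>rat_field\<^esub> y = x * y" "\<one>\<^bsub>rat_field\<^esub> = 1"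
  "\<zero>\<^bsub>rat_field\<^esub> = 0" "x \<oplus>\<^bsub>rat_field\<^esub> y = x + y"
  by (simp_all add: rat_field_def)

context rat_algebra
begin

declare prod_closed [simp]

lemmas closed_simps = prod_closed smult_closed add.m_closed zero_closed

lemma smult_add_left: "x \<in> carrier A \<Longrightarrow> (q + r) \<odot> x = q \<odot> x \<oplus> r \<odot> x"
  using smult_l_distr[of q r x] by simp

lemma smult_smult: "x \<in> carrier A \<Longrightarrow> q \<odot> (r \<odot> x) = (q * r) \<odot> x"
  using smult_assoc1[of q r x] by simp

lemma smult_zero_left: "x \<in> carrier A \<Longrightarrow> 0 \<odot> x = \<zero>"
  using smult_l_null[of x] by simp

lemma smult_one_left: "x \<in> carrier A \<Longrightarrow> 1 \<odot> x = x"
  using smult_one[of x] by simp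

lemma smult_zero_right: "q \<odot> \<zero> = \<zero>"
  using smult_r_null[of q] by simp

lemma smult_add_right: "x \<in> carrier A \<Longrightarrow> y \<in> carrier A \<Longrightarrow> q \<odot> (x \<oplus> y) = q \<odot> x \<oplus> q \<odot> y"
  using smult_r_distr[of q x y] by simp

lemmas smult_simps = smult_smult smult_zero_left smult_one_left smult_zero_right smult_add_right

lemma add_neg: "x \<in> carrier A \<Longrightarrow> x \<oplus> (-1) \<odot> x = \<zero>"
  using smult_add_left[of x 1 "-1"] by (simp add: smult_simps)

lemma add_neg': "x \<in> carrier A \<Longrightarrow> y \<in> carrier A \<Longrightarrow> x \<oplus> ((-1) \<odot> x \<oplus> y) = y"
  by (simp add: a_assoc[symmetric] add_neg)

lemma prod_zero_left: "x \<in> carrier A \<Longrightarrow> \<zero> \<otimes> x = \<zero>"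
  using prod_smult_left[of "\<zero>" x 0] by (simp add: smult_simps)

lemma prod_zero_right: "x \<in> carrier A \<Longrightarrow> x \<otimes> \<zero> = \<zero>"
  using prod_smult_right[of x "\<zero>" 0] by (simp add: smult_simps)

text \<open>Every term after the main product contains one of the perturbations \<open>d\<close>,
  \<open>e\<close>. Leaving the factor \<open>r \<oplus> e\<close> unexpanded keeps the error at two
  terms.\<close>

lemma prod_add_add:
  assumes "p \<in> carrier A" "d \<in> carrier A" "r \<in> carrier A" "e \<in> carrier A"
  shows "(p \<oplus> d) \<otimes> (r \<oplus> e) = p \<otimes> r \<oplus> (p \<otimes> e \<oplus> d \<otimes> (r \<oplus> e))"
  using assms by (subst prod_add_left) (simp_all add: prod_add_right a_assoc)

definition subspace :: "'a set \<Rightarrow> bool" where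
  "subspace W \<longleftrightarrow> W \<subseteq> carrier A \<and> \<zero> \<in> W \<and>
     (\<forall>x\<in>W. \<forall>y\<in>W. x \<oplus> y \<in> W) \<and> (\<forall>x\<in>W. \<forall>q. q \<odot> x \<in> W)"

lemma subspaceD:
  assumes "subspace W"
  shows "x \<in> W \<Longrightarrow> x \<in> carrier A" "\<zero> \<in> W" "x \<in> W \<Longrightarrow> y \<in> W \<Longrightarrow> x \<oplus> y \<in> W"
    "x \<in> W \<Longrightarrow> q \<odot> x \<in> W"
  using assms by (auto simp: subspace_def)

lemma subspace_carrier: "subspace (carrier A)"
  by (auto simp: subspace_def)

text \<open>Membership in the carrier is part of the relation, so a congruence also records that
  both sides lie in the algebra.\<close>

definition cong_mod :: "'a set \<Rightarrow> 'a \<Rightarrow> 'a \<Rightarrow> bool" where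
  "cong_mod W x y \<longleftrightarrow> x \<in> carrier A \<and> y \<in> carrier A \<and> (\<exists>d\<in>W. x = y \<oplus> d)"

lemma cong_mod_closed: "cong_mod W x y \<Longrightarrow> x \<in> carrier A" "cong_mod W x y \<Longrightarrow> y \<in> carrier A"
  by (auto simp: cong_mod_def)

lemma cong_mod_mono: "cong_mod W x y \<Longrightarrow> W \<subseteq> V \<Longrightarrow> cong_mod V x y"
  by (auto simp: cong_mod_def)

lemma cong_mod_refl: "subspace W \<Longrightarrow> x \<in> carrier A \<Longrightarrow> cong_mod W x x"
  unfolding cong_mod_def using subspaceD(2)[of W] by (force intro: bexI[of _ "\<zero>"])

lemma cong_mod_sym:
  assumes "subspace W" "cong_mod W x y"
  shows "cong_mod W y x"
proof -
  obtain d where d: "d \<in> W" "x = y \<oplus> d" "x \<in> carrier A" "y \<in> carrier A"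
    using assms by (auto simp: cong_mod_def)
  have "d \<in> carrier A" using d assms subspaceD by blast
  then have "y = x \<oplus> (-1) \<odot> d" using d by (simp add: a_assoc add_neg)
  then show ?thesis using d subspaceD(4)[OF assms(1)] unfolding cong_mod_def by blast
qed

lemma cong_mod_trans [trans]:
  assumes "cong_mod W x y" "cong_mod W y z" "subspace W"
  shows "cong_mod W x z"
proof -
  obtain d e where d: "d \<in> W" "x = y \<oplus> d" "e \<in> W" "y = z \<oplus> e" "x \<in> carrier A" "z \<in> carrier A"
    using assms by (auto simp: cong_mod_def)
  have "d \<in> carrier A" "e \<in> carrier A" using d assms subspaceD by blast+
  then have "x = z \<oplus> (e \<oplus> d)" using d by (simp add: a_assoc)
  then show ?thesis using d subspaceD(3)[OF assms(3)] unfolding cong_mod_def by blast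
qed

lemma cong_mod_add:
  assumes "subspace W" "cong_mod W x y" "cong_mod W x' y'"
  shows "cong_mod W (x \<oplus> x') (y \<oplus> y')"
proof -
  obtain d e where d: "d \<in> W" "x = y \<oplus> d" "e \<in> W" "x' = y' \<oplus> e" "y \<in> carrier A" "y' \<in> carrier A"
    using assms by (auto simp: cong_mod_def)
  have de: "d \<in> carrier A" "e \<in> carrier A" using d assms subspaceD by blast+
  then have "x \<oplus> x' = (y \<oplus> y') \<oplus> (d \<oplus> e)" using d by (simp add: a_ac)
  then show ?thesis using d de subspaceD(3)[OF assms(1)] unfolding cong_mod_def
    by (metis closed_simps(3))
qed

lemma cong_mod_smult:
  assumes "subspace W" "cong_mod W x y"
  shows "cong_mod W (q \<odot> x) (q \<odot> y)"
proof -
  obtain d where d: "d \<in> W" "x = y \<oplus> d" "x \<in> carrier A" "y \<in> carrier A"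
    using assms by (auto simp: cong_mod_def)
  have "d \<in> carrier A" using d assms subspaceD by blast
  then have "q \<odot> x = q \<odot> y \<oplus> q \<odot> d" using d by (simp add: smult_add_right)
  moreover have "q \<odot> x \<in> carrier A" "q \<odot> y \<in> carrier A" using d by auto
  ultimately show ?thesis using d subspaceD(4)[OF assms(1)] unfolding cong_mod_def by blast
qed

lemma cong_mod_cancel:
  assumes "subspace W" "cong_mod W (x \<oplus> y) (x' \<oplus> y')" "cong_mod W x x'"
    "y \<in> carrier A" "y' \<in> carrier A"
  shows "cong_mod W y y'"
proof -
  have "cong_mod W ((x \<oplus> y) \<oplus> (-1) \<odot> x) ((x' \<oplus> y') \<oplus> (-1) \<odot> x')"
    by (intro cong_mod_add cong_mod_smult assms)
  moreover have "(u \<oplus> v) \<oplus> (-1) \<odot> u = v" if "u \<in> carrier A" "v \<in> carrier A" for u v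
    using that by (metis a_comm add_neg' rat_field_simps(1) smult_closed UNIV_I closed_simps(3) a_assoc)
  ultimately show ?thesis using assms by (simp add: cong_mod_closed)
qed

lemma cong_mod_zero: "subspace W \<Longrightarrow> cong_mod W x \<zero> \<longleftrightarrow> x \<in> W"
  unfolding cong_mod_def using subspaceD(1)[of W] by force

lemma cong_mod_carrier: "x \<in> carrier A \<Longrightarrow> y \<in> carrier A \<Longrightarrow> cong_mod (carrier A) x y"
  using cong_mod_zero[OF subspace_carrier] cong_mod_trans[OF _ _ subspace_carrier]
    cong_mod_sym[OF subspace_carrier] by blast

lemma cong_mod_add_right:
  "subspace W \<Longrightarrow> x \<in> carrier A \<Longrightarrow> d \<in> W \<Longrightarrow> cong_mod W (x \<oplus> d) x"
  unfolding cong_mod_def using subspaceD(1)[of W] by auto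

lemma cong_mod_trivial: "cong_mod {\<zero>} x y \<Longrightarrow> x = y"
  by (auto simp: cong_mod_def)

lemma cong_mod_finsum:
  assumes "finite S" "subspace W" "\<And>t. t \<in> S \<Longrightarrow> cong_mod W (p t) (r t)"
  shows "cong_mod W (\<Oplus>t\<in>S. p t) (\<Oplus>t\<in>S. r t)"
  using assms
proof (induction S rule: finite_induct)
  case empty
  then show ?case by (simp add: cong_mod_refl)
next
  case (insert t S)
  have "p \<in> insert t S \<rightarrow> carrier A" "r \<in> insert t S \<rightarrow> carrier A"
    using insert.prems cong_mod_closed by blast+
  then show ?case using insert by (simp add: cong_mod_add)
qed

lemma finsum_subspace:
  assumes "finite S" "subspace W" "\<And>t. t \<in> S \<Longrightarrow> p t \<in> W"
  shows "(\<Oplus>t\<in>S. p t) \<in> W"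
  using cong_mod_finsum[OF assms(1,2), of p "\<lambda>_. \<zero>"] assms
  by (simp add: cong_mod_zero)

end

section \<open>Monomials in an anticommutative algebra\<close>

context anticommutative_rat_algebra
begin

text \<open>Polarisation of the identity \<open>x \<otimes> x = \<zero>\<close> at
  \<open>x \<oplus> y\<close>.\<close>

lemma anticomm:
  assumes "x \<in> carrier A" "y \<in> carrier A"
  shows "y \<otimes> x = (-1) \<odot> (x \<otimes> y)"
proof -
  have "\<zero> = (x \<oplus> y) \<otimes> (x \<oplus> y)" using assms by (simp add: prod_square)
  also have "\<dots> = x \<otimes> y \<oplus> y \<otimes> x"
    using assms by (subst prod_add_left) (simp_all add: prod_add_right prod_square)
  finally have "x \<otimes> y \<oplus> y \<otimes> x = x \<otimes> y \<oplus> (-1) \<odot> (x \<otimes> y)"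
    using assms by (simp add: add_neg)
  then show ?thesis using assms by simp
qed

lemma prod_same_line: "x \<in> carrier A \<Longrightarrow> (q \<odot> x) \<otimes> (r \<odot> x) = \<zero>"
  by (simp add: prod_smult_left prod_smult_right prod_square smult_simps)

lemma eval_monomial_subalgebra:
  assumes "\<And>x y. x \<in> D \<Longrightarrow> y \<in> D \<Longrightarrow> x \<otimes> y \<in> D" "\<And>v. \<rho> v \<in> D"
  shows "eval_monomial A \<rho> t \<in> D"
  by (induction t) (auto simp: assms)

lemma eval_monomial_closed: "(\<And>v. \<rho> v \<in> carrier A) \<Longrightarrow> eval_monomial A \<rho> t \<in> carrier A"
  by (rule eval_monomial_subalgebra) auto

lemma monomial_degree_pos: "monomial_degree t \<ge> 1"
  by (induction t) auto

text \<open>A product of two multiples of \<open>x\<close> is a multiple of the square of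
  \<open>x\<close>, hence zero. That every value is again a multiple of \<open>x\<close> carries the
  induction.\<close>

lemma eval_monomial_line:
  assumes "x \<in> carrier A" "\<And>v. \<exists>q. \<rho> v = q \<odot> x"
  shows "(\<exists>q. eval_monomial A \<rho> t = q \<odot> x) \<and> (monomial_degree t \<ge> 2 \<longrightarrow> eval_monomial A \<rho> t = \<zero>)"
proof (induction t)
  case (Letter v)
  then show ?case using assms by simp
next
  case (Prod s t)
  then have "eval_monomial A \<rho> (Prod s t) = \<zero>" using assms by (auto simp: prod_same_line)
  then show ?case using assms smult_zero_left by metis
qed

text \<open>A product changes only modulo \<open>J\<close> when its factors in \<open>D\<close> change modulo \<open>I\<close>; this is what
  makes the loop operation addition up to terms deeper in a central filtration.\<close>

lemma eval_monomial_cong: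
  assumes I: "subspace I" and J: "subspace J" and D: "D \<subseteq> carrier A" "\<And>x y. x \<in> D \<Longrightarrow> y \<in> D \<Longrightarrow> x \<otimes> y \<in> D"
    and JI: "J \<subseteq> I" and IJ: "\<And>x y. x \<in> I \<Longrightarrow> y \<in> D \<Longrightarrow> x \<otimes> y \<in> J"
    and \<rho>: "\<And>v. \<rho> v \<in> D" "\<And>v. \<rho>' v \<in> D" "\<And>v. cong_mod I (\<rho> v) (\<rho>' v)"
  shows "cong_mod I (eval_monomial A \<rho> t) (eval_monomial A \<rho>' t) \<and>
    (monomial_degree t \<ge> 2 \<longrightarrow> cong_mod J (eval_monomial A \<rho> t) (eval_monomial A \<rho>' t))"
proof (induction t)
  case (Letter v)
  then show ?case using \<rho> by simp
next
  case (Prod s t)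
  let ?e = "eval_monomial A \<rho>" and ?e' = "eval_monomial A \<rho>'"
  obtain d e where de: "d \<in> I" "e \<in> I" "?e s = ?e' s \<oplus> d" "?e t = ?e' t \<oplus> e"
    using Prod unfolding cong_mod_def by blast
  have D': "?e u \<in> D" "?e' u \<in> D" for u
    using eval_monomial_subalgebra \<rho> D by blast+
  note c = subsetD[OF D(1) D'(1)] subsetD[OF D(1) D'(2)] subspaceD(1)[OF I de(1)] subspaceD(1)[OF I de(2)]
  have "?e s \<otimes> ?e t = ?e' s \<otimes> ?e' t \<oplus> (?e' s \<otimes> e \<oplus> d \<otimes> ?e t)"
    unfolding de(3,4) by (rule prod_add_add) (use c in auto)
  \<comment> \<open>\<open>IJ\<close> controls only products with the element of \<open>I\<close> on
    the left, so anticommutativity moves \<open>e\<close> there; the sign is absorbed by the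
    subspace \<open>J\<close>.\<close>
  moreover have "?e' s \<otimes> e = (-1) \<odot> (e \<otimes> ?e' s)" by (rule anticomm) (use c in auto)
  then have "?e' s \<otimes> e \<oplus> d \<otimes> ?e t \<in> J"
    using subspaceD(3)[OF J subspaceD(4)[OF J IJ[OF de(2) D'(2)]] IJ[OF de(1) D'(1)]] by simp
  ultimately have "cong_mod J (eval_monomial A \<rho> (Prod s t)) (eval_monomial A \<rho>' (Prod s t))"
    using c unfolding cong_mod_def by auto
  then show ?case using cong_mod_mono JI by blast
qed

end

section \<open>The loop operation\<close>

locale circ_algebra = anticommutative_rat_algebra A
  for A :: "(rat, 'a) module" (structure) +
  fixes k l m n :: rat and f :: "var monomial \<Rightarrow> rat"
  assumes finite_support: "finite {t. f t \<noteq> 0}"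
    and support_degree: "f t \<noteq> 0 \<Longrightarrow> monomial_degree t \<ge> 3"
begin

abbreviation op :: "'a \<Rightarrow> 'a \<Rightarrow> 'a"  (infixl "\<circle>" 65) where
  "a \<circle> b \<equiv> circ A k l m n f a b"

definition higher :: "'a \<Rightarrow> 'a \<Rightarrow> 'a" where
  "higher a b = (\<Oplus>t\<in>{t. f t \<noteq> 0}. f t \<odot> eval_monomial A (assign a b) t)"

text \<open>The nonlinear part of \<open>\<circle>\<close>: anticommutativity merges the mixed terms
  with coefficients \<open>k\<close> and \<open>l\<close> into one with coefficient
  \<open>k - l\<close>, and the squares vanish.\<close>

definition corr :: "'a \<Rightarrow> 'a \<Rightarrow> 'a" where
  "corr a b = (k - l) \<odot> (a \<otimes> b) \<oplus> higher a b"

lemma assign_in: "a \<in> D \<Longrightarrow> b \<in> D \<Longrightarrow> assign a b v \<in> D"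
  by (cases v) auto

lemma higher_closed [simp]: "a \<in> carrier A \<Longrightarrow> b \<in> carrier A \<Longrightarrow> higher a b \<in> carrier A"
  unfolding higher_def
  by (intro finsum_closed) (auto simp: eval_monomial_closed assign_in)

lemma corr_closed [simp]: "a \<in> carrier A \<Longrightarrow> b \<in> carrier A \<Longrightarrow> corr a b \<in> carrier A"
  by (simp add: corr_def)

lemma circ_eq:
  assumes "a \<in> carrier A" "b \<in> carrier A"
  shows "a \<circle> b = a \<oplus> b \<oplus> corr a b"
proof -
  have "(k - l) \<odot> (a \<otimes> b) = k \<odot> (a \<otimes> b) \<oplus> l \<odot> (b \<otimes> a)"
    using assms smult_add_left[of "a \<otimes> b" k "-l"]
    by (simp add: anticomm[of a b] smult_simps)
  moreover have "higher a b = \<zero> \<oplus> \<zero> \<oplus> higher a b" using assms by simp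
  ultimately show ?thesis using assms
    by (simp add: circ_def corr_def prod_square smult_simps higher_def[symmetric] a_assoc)
qed

lemma circ_closed [simp]: "a \<in> carrier A \<Longrightarrow> b \<in> carrier A \<Longrightarrow> a \<circle> b \<in> carrier A"
  by (simp add: circ_eq)

text \<open>All monomials in \<open>corr\<close> have degree at least 2, and here their letters are
  multiples of a single element.\<close>

lemma corr_line: 
  assumes "x \<in> carrier A"
  shows "corr (q \<odot> x) (r \<odot> x) = \<zero>"
proof -
  have "eval_monomial A (assign (q \<odot> x) (r \<odot> x)) t = \<zero>" if "f t \<noteq> 0" for t
  proof -
    have "\<exists>s. assign (q \<odot> x) (r \<odot> x) v = s \<odot> x" for v by (cases v) auto
    then show ?thesis using eval_monomial_line[OF assms] support_degree[OF that] by fastforce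
  qed
  then have "higher (q \<odot> x) (r \<odot> x) = (\<Oplus>t\<in>{t. f t \<noteq> 0}. \<zero>)"
    unfolding higher_def by (intro finsum_cong') (auto simp: smult_simps)
  then show ?thesis using assms by (simp add: corr_def prod_same_line smult_simps)
qed

text \<open>On a line through zero the loop operation is vector addition; this is why loop powers
  turn out to be scalar multiples.\<close>

lemma circ_line: "x \<in> carrier A \<Longrightarrow> (q \<odot> x) \<circle> (r \<odot> x) = (q + r) \<odot> x"
  by (simp add: circ_eq corr_line smult_add_left)

lemma corr_zero_left: "x \<in> carrier A \<Longrightarrow> corr \<zero> x = \<zero>"
  using corr_line[of x 0 1] by (simp add: smult_simps)

lemma corr_zero_right: "x \<in> carrier A \<Longrightarrow> corr x \<zero> = \<zero>"
  using corr_line[of x 1 0] by (simp add: smult_simps)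

lemma circ_zero_left: "x \<in> carrier A \<Longrightarrow> \<zero> \<circle> x = x"
  by (simp add: circ_eq corr_zero_left)

lemma circ_zero_right: "x \<in> carrier A \<Longrightarrow> x \<circle> \<zero> = x"
  by (simp add: circ_eq corr_zero_right)

text \<open>Only monomials of degree at least 2 occur in \<open>corr\<close>, so each of them gains
  the step from \<open>I\<close> to \<open>J\<close>. The subalgebra \<open>D\<close> is a parameter
  because two filtrations use this: the annihilator series with the whole algebra, and the degree
  filtration with the subalgebra generated by two elements.\<close>

lemma corr_cong:
  assumes I: "subspace I" and J: "subspace J" and D: "D \<subseteq> carrier A" "\<And>x y. x \<in> D \<Longrightarrow> y \<in> D \<Longrightarrow> x \<otimes> y \<in> D"
    and JI: "J \<subseteq> I" and IJ: "\<And>x y. x \<in> I \<Longrightarrow> y \<in> D \<Longrightarrow> x \<otimes> y \<in> J"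
    and ab: "a \<in> D" "b \<in> D" "a' \<in> D" "b' \<in> D" "cong_mod I a a'" "cong_mod I b b'"
  shows "cong_mod J (corr a b) (corr a' b')"
proof -
  have *: "cong_mod J (eval_monomial A (assign a b) t) (eval_monomial A (assign a' b') t)"
    if "monomial_degree t \<ge> 2" for t
  proof -
    have "cong_mod I (assign a b v) (assign a' b' v)" for v using ab by (cases v) auto
    from eval_monomial_cong[where t = t, OF I J D JI IJ _ _ this] that ab show ?thesis
      by (simp add: assign_in)
  qed
  have "cong_mod J (a \<otimes> b) (a' \<otimes> b')"
    using *[of "Prod (Letter X) (Letter Y)"] by simp
  moreover have "cong_mod J (higher a b) (higher a' b')"
    unfolding higher_def
  proof (rule cong_mod_finsum[OF finite_support J])
    fix t assume "t \<in> {t. f t \<noteq> 0}"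
    then show "cong_mod J (f t \<odot> eval_monomial A (assign a b) t) (f t \<odot> eval_monomial A (assign a' b') t)"
      using support_degree[of t] by (intro cong_mod_smult J *) auto
  qed
  ultimately show ?thesis unfolding corr_def by (intro cong_mod_add cong_mod_smult J)
qed

end

section \<open>The upper annihilator series\<close>

context rat_algebra
begin

text \<open>The analogue of the upper central series of a group. Under anticommutativity the
  one-sided condition is two-sided, since every level is a subspace.\<close>

primrec upper_ann :: "nat \<Rightarrow> 'a set" where
  "upper_ann 0 = {\<zero>}"
| "upper_ann (Suc i) = {x \<in> carrier A. \<forall>y \<in> carrier A. x \<otimes> y \<in> upper_ann i}"

lemma upper_ann_subspace: "subspace (upper_ann i)"
proof (induction i)
  case 0
  then show ?case by (simp add: subspace_def smult_simps)
next
  case (Suc i)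
  then show ?case
    unfolding subspace_def
    by (auto simp: prod_add_left prod_smult_left prod_zero_left)
qed

lemma upper_ann_Suc: "upper_ann i \<subseteq> upper_ann (Suc i)"
proof (induction i)
  case 0
  then show ?case by (auto simp: prod_zero_left)
next
  case (Suc i)
  then show ?case by auto
qed

lemma upper_ann_mono: "i \<le> j \<Longrightarrow> upper_ann i \<subseteq> upper_ann j"
  by (rule lift_Suc_mono_le[of upper_ann]) (auto simp only: upper_ann_Suc)

lemma upper_ann_closed: "x \<in> upper_ann i \<Longrightarrow> x \<in> carrier A"
  using upper_ann_subspace subspaceD(1) by blast

text \<open>Multiplying by one more element raises the degree by one and must lower the level by
  one. So monomials of degree \<open>c + 1 - i\<close> lie in level \<open>i\<close>, and for
  \<open>i = c\<close> these are the single letters.\<close>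

lemma upper_ann_eq_carrier:
  assumes nil: "\<And>t. letters t \<subseteq> carrier A \<Longrightarrow> monomial_degree t = c + 1 \<Longrightarrow> eval_monomial A id t = \<zero>"
  shows "upper_ann c = carrier A"
proof -
  have ev: "letters t \<subseteq> carrier A \<Longrightarrow> eval_monomial A id t \<in> carrier A" for t
    by (induction t) auto
  have "eval_monomial A id t \<in> upper_ann i"
    if "i \<le> c" "letters t \<subseteq> carrier A" "monomial_degree t = c + 1 - i" for i t
    using that
  proof (induction i arbitrary: t)
    case 0
    then show ?case using nil[of t] by (simp add: id_def)
  next
    case (Suc i)
    have "eval_monomial A id t \<otimes> y \<in> upper_ann i" if "y \<in> carrier A" for y
      using Suc.IH[of "Prod t (Letter y)"] Suc.prems that by (simp add: id_def Suc_diff_le)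
    then show ?case using ev Suc.prems by (simp add: id_def)
  qed
  from this[of c "Letter x" for x] have "carrier A \<subseteq> upper_ann c" by auto
  then show ?thesis using upper_ann_closed by blast
qed

text \<open>A perturbation of the identity that lowers the level in the annihilator series is invertible,
  by successive approximation.\<close>

lemma perturbation_solve:
  assumes nil: "upper_ann c = carrier A"
    and \<phi>: "\<And>y. y \<in> carrier A \<Longrightarrow> \<phi> y \<in> carrier A"
      "\<And>i y y'. cong_mod (upper_ann (Suc i)) y y' \<Longrightarrow> cong_mod (upper_ann i) (\<phi> y) (\<phi> y')"
    and z: "z \<in> carrier A"
  shows "\<exists>y \<in> carrier A. y \<oplus> \<phi> y = z"
proof -
  \<comment> \<open>After \<open>i\<close> rounds the equation holds modulo level
    \<open>c - i\<close>. Level \<open>c\<close> imposes no condition, so zero is a valid start;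
    level 0 gives equality.\<close>
  have "\<exists>y. cong_mod (upper_ann (c - i)) z (y \<oplus> \<phi> y) \<and> y \<in> carrier A" if "i \<le> c" for i
    using that
  proof (induction i)
    case 0
    show ?case using nil z \<phi>(1)[of \<zero>] by (auto intro!: exI[of _ \<zero>] cong_mod_carrier)
  next
    case (Suc i)
    let ?j = "c - Suc i"
    note S = upper_ann_subspace[of ?j]
    have j: "c - i = Suc ?j" using Suc.prems by simp
    obtain y d where y: "y \<in> carrier A" "z = (y \<oplus> \<phi> y) \<oplus> d" "d \<in> upper_ann (Suc ?j)"
      using Suc unfolding cong_mod_def j by auto
    note c = \<phi>(1)[OF y(1)] y(1) upper_ann_closed[OF y(3)]
    \<comment> \<open>The correction adds the defect \<open>d\<close> to \<open>y\<close>: this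
      removes \<open>d\<close> from the equation, while \<open>\<phi>\<close> changes only one level
      further down.\<close>
    have "cong_mod (upper_ann ?j) (\<phi> (y \<oplus> d)) (\<phi> y)"
      using c y upper_ann_subspace by (intro \<phi>(2) cong_mod_add_right)
    from cong_mod_sym[OF S this]
    have "cong_mod (upper_ann ?j) (y \<oplus> d \<oplus> \<phi> y) (y \<oplus> d \<oplus> \<phi> (y \<oplus> d))"
      using c by (intro cong_mod_add cong_mod_refl S) auto
    moreover have "z = y \<oplus> d \<oplus> \<phi> y" using y c by (simp add: a_ac)
    ultimately show ?case using c by auto
  qed
  from this[of c] obtain y where "cong_mod {\<zero>} z (y \<oplus> \<phi> y)" "y \<in> carrier A" by auto
  then show ?thesis using cong_mod_trivial by blast
qed

text \<open>Descend from the top level: once \<open>y\<close> and \<open>y'\<close> agree modulo one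
  level, their images under \<open>\<phi>\<close> agree modulo the next lower one and can be
  cancelled. Level 0 gives injectivity; the other levels give cancellation in the quotients.\<close>

lemma perturbation_cancel:
  assumes nil: "upper_ann c = carrier A"
    and \<phi>: "\<And>i y y'. cong_mod (upper_ann (Suc i)) y y' \<Longrightarrow> cong_mod (upper_ann i) (\<phi> y) (\<phi> y')"
    and y: "y \<in> carrier A" "y' \<in> carrier A"
    and eq: "cong_mod (upper_ann i) (y \<oplus> \<phi> y) (y' \<oplus> \<phi> y')"
  shows "cong_mod (upper_ann i) y y'"
proof (cases "i \<le> c")
  case le: True
  have "cong_mod (upper_ann (c - j)) y y'" if "j \<le> c - i" for j
    using that
  proof (induction j)
    case 0
    then show ?case using y nil by (simp add: cong_mod_carrier)
  next
    case (Suc j)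
    let ?j = "c - Suc j"
    note S = upper_ann_subspace[of ?j]
    have j: "c - j = Suc ?j" "i \<le> ?j" using Suc.prems by simp_all
    have p: "cong_mod (upper_ann ?j) (\<phi> y) (\<phi> y')" using Suc.IH[OF Suc_leD[OF Suc.prems]] unfolding j(1) by (rule \<phi>)
    have "cong_mod (upper_ann ?j) (y \<oplus> \<phi> y) (y' \<oplus> \<phi> y')"
      using eq cong_mod_mono upper_ann_mono j(2) by blast
    then have "cong_mod (upper_ann ?j) (\<phi> y \<oplus> y) (\<phi> y' \<oplus> y')"
      using cong_mod_closed[OF p] y by (simp add: a_comm)
    then show ?case using p y by (rule cong_mod_cancel[OF S])
  qed
  from this[of "c - i"] show ?thesis using le by simp
next
  case False
  then have "upper_ann i = carrier A"
    using upper_ann_mono[of c i] nil upper_ann_closed by auto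
  then show ?thesis using y by (simp add: cong_mod_carrier)
qed

end

section \<open>Division and cancellation for the loop operation\<close>

locale nilpotent_circ_algebra = circ_algebra +
  fixes c :: nat
  assumes upper_ann_top: "upper_ann c = carrier A"
begin

lemma corr_upper_ann:
  assumes "cong_mod (upper_ann (Suc i)) a a'" "cong_mod (upper_ann (Suc i)) b b'"
  shows "cong_mod (upper_ann i) (corr a b) (corr a' b')"
  by (rule corr_cong[OF upper_ann_subspace[of "Suc i"] upper_ann_subspace subset_refl _ upper_ann_Suc])
    (use assms in \<open>auto simp: cong_mod_closed prod_closed\<close>)

lemma circ_cong:
  assumes "cong_mod (upper_ann i) a a'" "cong_mod (upper_ann i) b b'"
  shows "cong_mod (upper_ann i) (a \<circle> b) (a' \<circle> b')"
proof -
  note c = cong_mod_closed[OF assms(1)] cong_mod_closed[OF assms(2)]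
  note S = upper_ann_subspace[of i]
  have "cong_mod (upper_ann i) (corr a b) (corr a' b')"
    using assms cong_mod_mono upper_ann_Suc by (blast intro: corr_upper_ann)
  then show ?thesis using assms c by (auto simp: circ_eq intro!: cong_mod_add S)
qed

text \<open>For fixed \<open>a\<close>, left translation has the form
  \<open>y \<oplus> \<phi> y\<close> with \<open>\<phi> y = a \<oplus> corr a y\<close>, as the
  perturbation lemmas require; the constant \<open>a\<close> does not affect differences.\<close>

lemma perturbation_left:
  assumes "a \<in> carrier A"
  shows "y \<in> carrier A \<Longrightarrow> a \<circle> y = y \<oplus> (a \<oplus> corr a y)"
    "cong_mod (upper_ann (Suc i)) y y' \<Longrightarrow> cong_mod (upper_ann i) (a \<oplus> corr a y) (a \<oplus> corr a y')"
  using assms cong_mod_refl[OF upper_ann_subspace, OF assms]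
  by (simp_all add: circ_eq a_assoc a_lcomm cong_mod_add corr_upper_ann upper_ann_subspace del: upper_ann.simps)

lemma perturbation_right:
  assumes "b \<in> carrier A"
  shows "x \<in> carrier A \<Longrightarrow> x \<circle> b = x \<oplus> (b \<oplus> corr x b)"
    "cong_mod (upper_ann (Suc i)) x x' \<Longrightarrow> cong_mod (upper_ann i) (b \<oplus> corr x b) (b \<oplus> corr x' b)"
  using assms cong_mod_refl[OF upper_ann_subspace, OF assms]
  by (simp_all add: circ_eq a_assoc cong_mod_add corr_upper_ann upper_ann_subspace del: upper_ann.simps)

lemma circ_left_solve:
  assumes "a \<in> carrier A" "z \<in> carrier A"
  shows "\<exists>y \<in> carrier A. a \<circle> y = z"
  using perturbation_solve[OF upper_ann_top, of "\<lambda>y. a \<oplus> corr a y"] perturbation_left[OF assms(1)] assms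
  by (metis closed_simps(3) corr_closed)

lemma circ_right_solve:
  assumes "b \<in> carrier A" "z \<in> carrier A"
  shows "\<exists>x \<in> carrier A. x \<circle> b = z"
  using perturbation_solve[OF upper_ann_top, of "\<lambda>x. b \<oplus> corr x b"] perturbation_right[OF assms(1)] assms
  by (metis closed_simps(3) corr_closed)

lemma circ_left_cancel:
  assumes "a \<in> carrier A" "y \<in> carrier A" "y' \<in> carrier A" "cong_mod (upper_ann i) (a \<circle> y) (a \<circle> y')"
  shows "cong_mod (upper_ann i) y y'"
  using perturbation_cancel[OF upper_ann_top, of "\<lambda>y. a \<oplus> corr a y"] perturbation_left[OF assms(1)] assms
  by (metis (no_types, lifting))

lemma circ_right_cancel:
  assumes "b \<in> carrier A" "x \<in> carrier A" "x' \<in> carrier A" "cong_mod (upper_ann i) (x \<circle> b) (x' \<circle> b)"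
  shows "cong_mod (upper_ann i) x x'"
  using perturbation_cancel[OF upper_ann_top, of "\<lambda>x. b \<oplus> corr x b"] perturbation_right[OF assms(1)] assms
  by (metis (no_types, lifting))

lemma circ_left_inj: "a \<in> carrier A \<Longrightarrow> y \<in> carrier A \<Longrightarrow> y' \<in> carrier A \<Longrightarrow> a \<circle> y = a \<circle> y' \<Longrightarrow> y = y'"
  using circ_left_cancel[of a y y' 0] cong_mod_refl[OF upper_ann_subspace[of 0]] cong_mod_trivial by auto

lemma circ_right_inj: "b \<in> carrier A \<Longrightarrow> x \<in> carrier A \<Longrightarrow> x' \<in> carrier A \<Longrightarrow> x \<circle> b = x' \<circle> b \<Longrightarrow> x = x'"
  using circ_right_cancel[of b x x' 0] cong_mod_refl[OF upper_ann_subspace[of 0]] cong_mod_trivial by auto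

section \<open>The loop \<open>Q\<close>, its powers and roots\<close>

abbreviation Q :: "'a monoid" where "Q \<equiv> loop_of A k l m n f"

lemma Q_simps [simp]: "carrier Q = carrier A" "mult Q = circ A k l m n f" "one Q = \<zero>"
  by (simp_all add: loop_of_def)

lemma Q_loop: "loop Q"
proof unfold_locales
  fix a z assume "a \<in> carrier Q" "z \<in> carrier Q"
  then show "\<exists>!y. y \<in> carrier Q \<and> a \<otimes>\<^bsub>Q\<^esub> y = z" "\<exists>!x. x \<in> carrier Q \<and> x \<otimes>\<^bsub>Q\<^esub> a = z"
    unfolding Q_simps using circ_left_solve[of a z] circ_right_solve[of a z] circ_left_inj circ_right_inj
    by metis+
qed (auto simp: circ_zero_left circ_zero_right)

lemma Q_nat_pow: "a \<in> carrier A \<Longrightarrow> a [^]\<^bsub>Q\<^esub> (i::nat) = of_nat i \<odot> a"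
proof (induction i)
  case 0
  then show ?case by (simp add: smult_zero_left)
next
  case (Suc i)
  then show ?case using circ_line[of a "of_nat i" 1] by (simp add: smult_one_left add.commute)
qed

text \<open>\<open>m_inv\<close> is a definite description; as \<open>Q\<close> need not be a group,
  uniqueness comes from left cancellation in the loop.\<close>

lemma Q_inv:
  assumes "a \<in> carrier A"
  shows "inv\<^bsub>Q\<^esub> a = (-1) \<odot> a"
  unfolding m_inv_def
proof (rule the_equality)
  show *: "(-1) \<odot> a \<in> carrier Q \<and> a \<otimes>\<^bsub>Q\<^esub> ((-1) \<odot> a) = \<one>\<^bsub>Q\<^esub> \<and> ((-1) \<odot> a) \<otimes>\<^bsub>Q\<^esub> a = \<one>\<^bsub>Q\<^esub>"
    using assms circ_line[OF assms, of 1 "-1"] circ_line[OF assms, of "-1" 1]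
    by (simp add: smult_one_left smult_zero_left)
  fix y assume "y \<in> carrier Q \<and> a \<otimes>\<^bsub>Q\<^esub> y = \<one>\<^bsub>Q\<^esub> \<and> y \<otimes>\<^bsub>Q\<^esub> a = \<one>\<^bsub>Q\<^esub>"
  then show "y = (-1) \<odot> a" using * circ_left_inj[OF assms, of y "(-1) \<odot> a"] by simp
qed

lemma Q_int_pow: "a \<in> carrier A \<Longrightarrow> a [^]\<^bsub>Q\<^esub> (i::int) = of_int i \<odot> a"
  unfolding int_pow_def2 by (simp add: Q_nat_pow Q_inv smult_smult del: pow_nat)

lemma Q_rat_pow:
  assumes "a \<in> carrier A"
  shows "rat_pow Q a q = q \<odot> a"
  unfolding rat_pow_def
proof (rule the_equality)
  show *: "q \<odot> a \<in> carrier Q \<and> (\<forall>(s::int) (t::nat). t \<ge> 1 \<and> q = of_int s / of_nat t \<longrightarrow>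
      (q \<odot> a) [^]\<^bsub>Q\<^esub> t = a [^]\<^bsub>Q\<^esub> s)"
    using assms by (auto simp: Q_nat_pow Q_int_pow smult_simps)
  fix x
  assume x: "x \<in> carrier Q \<and> (\<forall>(s::int) (t::nat). t \<ge> 1 \<and> q = of_int s / of_nat t \<longrightarrow>
      x [^]\<^bsub>Q\<^esub> t = a [^]\<^bsub>Q\<^esub> s)"
  \<comment> \<open>The definition quantifies over all fractions equal to \<open>q\<close>; for
    uniqueness a single one is enough, and the reduced fraction provides it.\<close>
  obtain s t where st: "quotient_of q = (s, t)" by fastforce
  obtain t' where t': "t = int t'" "t' \<noteq> 0"
    using quotient_of_denom_pos[OF st] by (metis pos_int_cases less_irrefl)
  then have q: "q = of_int s / of_nat t'" using quotient_of_div[OF st] by simp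
  then have "x [^]\<^bsub>Q\<^esub> t' = a [^]\<^bsub>Q\<^esub> s" using x t' by simp
  then have "of_nat t' \<odot> x = of_int s \<odot> a" using x assms by (simp add: Q_nat_pow Q_int_pow)
  then have "(1 / of_nat t') \<odot> (of_nat t' \<odot> x) = (1 / of_nat t') \<odot> (of_int s \<odot> a)" by simp
  then show "x = q \<odot> a" using x assms q t' by (simp add: smult_simps)
qed

lemma Q_uniquely_divisible: "uniquely_divisible_loop Q"
proof -
  interpret loop Q by (rule Q_loop)
  \<comment> \<open>The subgroup witnessing power-associativity is the rational line through
    \<open>a\<close>, where \<open>\<circle>\<close> is addition.\<close>
  have line: "group (Q\<lparr>carrier := range (\<lambda>q. q \<odot> a)\<rparr>)" if a: "a \<in> carrier A" for a
  proof (rule groupI)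
    fix x assume "x \<in> carrier (Q\<lparr>carrier := range (\<lambda>q. q \<odot> a)\<rparr>)"
    then obtain q where q: "x = q \<odot> a" by auto
    have "((-q) \<odot> a) \<circle> x = \<zero>" using a q by (simp add: circ_line smult_zero_left)
    then show "\<exists>y\<in>carrier (Q\<lparr>carrier := range (\<lambda>q. q \<odot> a)\<rparr>).
        y \<otimes>\<^bsub>Q\<lparr>carrier := range (\<lambda>q. q \<odot> a)\<rparr>\<^esub> x = \<one>\<^bsub>Q\<lparr>carrier := range (\<lambda>q. q \<odot> a)\<rparr>\<^esub>"
      by auto
  next
    show "\<one>\<^bsub>Q\<lparr>carrier := range (\<lambda>q. q \<odot> a)\<rparr>\<^esub> \<in> carrier (Q\<lparr>carrier := range (\<lambda>q. q \<odot> a)\<rparr>)"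
      using a smult_zero_left by (auto intro!: image_eqI[of _ _ 0])
  qed (use a in \<open>auto simp: circ_line circ_zero_left ac_simps\<close>)
  show ?thesis
  proof unfold_locales
    fix a assume a: "a \<in> carrier Q"
    show "\<exists>H \<subseteq> carrier Q. a \<in> H \<and> group (Q\<lparr>carrier := H\<rparr>)"
      using line[of a] a smult_one_left[of a]
      by (intro exI[of _ "range (\<lambda>q. q \<odot> a)"]) (auto intro!: image_eqI[of _ _ 1])
    fix i :: nat assume i: "1 \<le> i"
    show "\<exists>!x. x \<in> carrier Q \<and> x [^]\<^bsub>Q\<^esub> i = a"
    proof (rule ex1I[of _ "(1 / of_nat i) \<odot> a"])
      show "(1 / of_nat i) \<odot> a \<in> carrier Q \<and> ((1 / of_nat i) \<odot> a) [^]\<^bsub>Q\<^esub> i = a"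
        using a i by (simp add: Q_nat_pow smult_simps)
      show "x = (1 / of_nat i) \<odot> a" if "x \<in> carrier Q \<and> x [^]\<^bsub>Q\<^esub> i = a" for x
        using that i by (auto simp: Q_nat_pow smult_simps)
    qed
  qed
qed

section \<open>Cosets of the annihilator series\<close>

text \<open>Described by congruence instead of translation, so that it depends on the loop operation
  only through \<open>upper_ann_coset\<close>, where it is identified with the left and right cosets
  of the loop.\<close>

definition coset :: "nat \<Rightarrow> 'a \<Rightarrow> 'a set" where
  "coset i x = {y. cong_mod (upper_ann i) y x}"

lemma coset_eq_iff:
  assumes "x \<in> carrier A"
  shows "coset i x = coset i y \<longleftrightarrow> cong_mod (upper_ann i) x y"
proof
  assume "coset i x = coset i y"
  then show "cong_mod (upper_ann i) x y"
    using cong_mod_refl[OF upper_ann_subspace assms] unfolding coset_def by blast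
next
  assume *: "cong_mod (upper_ann i) x y"
  then show "coset i x = coset i y"
    using cong_mod_sym[OF upper_ann_subspace *] cong_mod_trans[OF _ _ upper_ann_subspace]
    unfolding coset_def by blast
qed

lemma coset_zero: "coset i \<zero> = upper_ann i"
  unfolding coset_def using cong_mod_zero[OF upper_ann_subspace] by blast

lemma coset_self: "x \<in> carrier A \<Longrightarrow> x \<in> coset i x"
  by (simp add: coset_def cong_mod_refl upper_ann_subspace del: upper_ann.simps)

lemma coset_closed: "coset i x \<subseteq> carrier A"
  by (auto simp: coset_def cong_mod_closed)

text \<open>A cycle of inclusions. Compatibility of \<open>\<circle>\<close> with congruence puts
  the product of the classes inside the class of \<open>a \<circle> b\<close>; conversely, an
  element of that class is divided by \<open>a\<close> or \<open>b\<close>, and cancellation modulo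
  level \<open>i\<close> locates the quotient.\<close>

lemma coset_set_mult:
  assumes "a \<in> carrier A" "b \<in> carrier A"
  shows "coset i a <#>\<^bsub>Q\<^esub> coset i b = coset i (a \<circle> b)"
    and "coset i a #>\<^bsub>Q\<^esub> b = coset i (a \<circle> b)"
    and "a <#\<^bsub>Q\<^esub> coset i b = coset i (a \<circle> b)"
proof -
  have 1: "coset i a <#>\<^bsub>Q\<^esub> coset i b \<subseteq> coset i (a \<circle> b)"
    unfolding set_mult_def coset_def using circ_cong by auto
  have 2: "coset i (a \<circle> b) \<subseteq> coset i a #>\<^bsub>Q\<^esub> b"
  proof
    fix z assume z: "z \<in> coset i (a \<circle> b)"
    then obtain y where y: "y \<in> carrier A" "y \<circle> b = z"
      using circ_right_solve[OF assms(2)] coset_closed by blast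
    have "cong_mod (upper_ann i) y a"
      by (rule circ_right_cancel[OF assms(2)]) (use z assms y in \<open>auto simp: coset_def\<close>)
    then show "z \<in> coset i a #>\<^bsub>Q\<^esub> b" using y unfolding r_coset_def coset_def by auto
  qed
  have 3: "coset i (a \<circle> b) \<subseteq> a <#\<^bsub>Q\<^esub> coset i b"
  proof
    fix z assume z: "z \<in> coset i (a \<circle> b)"
    then obtain y where y: "y \<in> carrier A" "a \<circle> y = z"
      using circ_left_solve[OF assms(1)] coset_closed by blast
    have "cong_mod (upper_ann i) y b"
      by (rule circ_left_cancel[OF assms(1)]) (use z assms y in \<open>auto simp: coset_def\<close>)
    then show "z \<in> a <#\<^bsub>Q\<^esub> coset i b" using y unfolding l_coset_def coset_def by auto
  qed
  have 4: "coset i a #>\<^bsub>Q\<^esub> b \<subseteq> coset i a <#>\<^bsub>Q\<^esub> coset i b" "a <#\<^bsub>Q\<^esub> coset i b \<subseteq> coset i a <#>\<^bsub>Q\<^esub> coset i b"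
    unfolding r_coset_def l_coset_def set_mult_def using coset_self assms by auto
  show "coset i a <#>\<^bsub>Q\<^esub> coset i b = coset i (a \<circle> b)" "coset i a #>\<^bsub>Q\<^esub> b = coset i (a \<circle> b)"
    "a <#\<^bsub>Q\<^esub> coset i b = coset i (a \<circle> b)"
    using 1 2 3 4 by blast+
qed

lemma upper_ann_coset:
  assumes "x \<in> carrier A"
  shows "upper_ann i #>\<^bsub>Q\<^esub> x = coset i x" "x <#\<^bsub>Q\<^esub> upper_ann i = coset i x"
  using coset_set_mult(2)[OF zero_closed assms] coset_set_mult(3)[OF assms zero_closed] assms
  by (simp_all add: coset_zero circ_zero_left circ_zero_right del: upper_ann.simps)

text \<open>Closure under division follows from cancellation modulo level \<open>i\<close>. The
  coset identities hold because all cosets involved are congruence classes.\<close>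

lemma upper_ann_normal: "normal_subloop (upper_ann i) Q"
proof -
  note S = upper_ann_subspace[of i]
  have Z: "x \<in> upper_ann i \<longleftrightarrow> cong_mod (upper_ann i) x \<zero>" for x
    using cong_mod_zero[OF S] by simp
  have circ: "a \<circle> b \<in> upper_ann i" if "a \<in> upper_ann i" "b \<in> upper_ann i" for a b
    using that circ_cong[of i a \<zero> b \<zero>] unfolding Z by (simp add: circ_zero_left)
  have left: "\<exists>!y. y \<in> upper_ann i \<and> a \<circle> y = z" if az: "a \<in> upper_ann i" "z \<in> upper_ann i" for a z
  proof -
    have ac: "a \<in> carrier A" "z \<in> carrier A" using az upper_ann_closed by blast+
    then obtain y where y: "y \<in> carrier A" "a \<circle> y = z" using circ_left_solve by blast
    \<comment> \<open>Both \<open>a \<circle> y\<close> and \<open>a \<circle> \<zero>\<close> are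
      congruent to zero, so cancelling \<open>a\<close> makes \<open>y\<close> congruent to
      zero.\<close>
    have "cong_mod (upper_ann i) (a \<circle> \<zero>) \<zero>" using az ac by (simp add: Z circ_zero_right del: upper_ann.simps)
    from cong_mod_trans[OF _ cong_mod_sym[OF S this] S] have "cong_mod (upper_ann i) (a \<circle> y) (a \<circle> \<zero>)"
      using az y unfolding Z by blast
    then have "y \<in> upper_ann i" using circ_left_cancel[OF ac(1) y(1) zero_closed] unfolding Z by blast
    then show ?thesis using y circ_left_inj[OF ac(1)] upper_ann_closed by blast
  qed
  have right: "\<exists>!x. x \<in> upper_ann i \<and> x \<circle> b = z" if bz: "b \<in> upper_ann i" "z \<in> upper_ann i" for b z
  proof -
    have bc: "b \<in> carrier A" "z \<in> carrier A" using bz upper_ann_closed by blast+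
    then obtain x where x: "x \<in> carrier A" "x \<circle> b = z" using circ_right_solve by blast
    have "cong_mod (upper_ann i) (\<zero> \<circle> b) \<zero>" using bz bc by (simp add: Z circ_zero_left del: upper_ann.simps)
    from cong_mod_trans[OF _ cong_mod_sym[OF S this] S] have "cong_mod (upper_ann i) (x \<circle> b) (\<zero> \<circle> b)"
      using bz x unfolding Z by blast
    then have "x \<in> upper_ann i" using circ_right_cancel[OF bc(1) x(1) zero_closed] unfolding Z by blast
    then show ?thesis using x circ_right_inj[OF bc(1)] upper_ann_closed by blast
  qed
  have "loop (Q\<lparr>carrier := upper_ann i\<rparr>)"
    by unfold_locales (use circ left right subspaceD(2)[OF S] upper_ann_closed circ_zero_left circ_zero_right in auto)
  then show ?thesis
    unfolding normal_subloop_def using upper_ann_closed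
    by (auto simp: upper_ann_coset coset_set_mult simp del: upper_ann.simps)
qed

text \<open>Changing an argument by an element of level \<open>Suc i\<close> changes
  \<open>corr\<close> only within level \<open>i\<close>, so modulo that level the change is purely
  additive.\<close>

lemma circ_upper_ann:
  assumes "x \<in> carrier A" "y \<in> carrier A" "z \<in> upper_ann (Suc i)"
  shows "cong_mod (upper_ann i) ((x \<oplus> z) \<circle> y) (x \<circle> y \<oplus> z)"
    and "cong_mod (upper_ann i) (x \<circle> (y \<oplus> z)) (x \<circle> y \<oplus> z)"
proof -
  note S = upper_ann_subspace[of i] and S' = upper_ann_subspace[of "Suc i"]
  have z: "z \<in> carrier A" using assms upper_ann_closed by blast
  have r: "cong_mod (upper_ann j) w w" if "w \<in> carrier A" for w j
    using cong_mod_refl[OF upper_ann_subspace that] .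
  have "cong_mod (upper_ann i) (corr (x \<oplus> z) y) (corr x y)"
    by (rule corr_upper_ann[OF cong_mod_add_right[OF S'] r]) (use assms in auto)
  from cong_mod_add[OF S r[of "x \<oplus> z \<oplus> y"] this]
  show "cong_mod (upper_ann i) ((x \<oplus> z) \<circle> y) (x \<circle> y \<oplus> z)"
    using assms(1,2) z by (simp add: circ_eq a_ac)
  have "cong_mod (upper_ann i) (corr x (y \<oplus> z)) (corr x y)"
    by (rule corr_upper_ann[OF r cong_mod_add_right[OF S']]) (use assms in auto)
  from cong_mod_add[OF S r[of "x \<oplus> z \<oplus> y"] this]
  show "cong_mod (upper_ann i) (x \<circle> (y \<oplus> z)) (x \<circle> y \<oplus> z)"
    using assms(1,2) z by (simp add: circ_eq a_ac)
qed

text \<open>Wherever \<open>z\<close> is inserted into a product, it can be pulled out as a summand.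
  Common normal forms such as \<open>x \<circle> y \<oplus> z\<close> then yield every commutation
  and association law required of a central element.\<close>

lemma coset_shift:
  assumes "x \<in> carrier A" "y \<in> carrier A" "z \<in> upper_ann (Suc i)"
  shows "coset i (z \<circle> x) = coset i (x \<oplus> z)" "coset i (x \<circle> z) = coset i (x \<oplus> z)"
    "coset i ((z \<circle> x) \<circle> y) = coset i (x \<circle> y \<oplus> z)" "coset i ((x \<circle> z) \<circle> y) = coset i (x \<circle> y \<oplus> z)"
    "coset i (x \<circle> (z \<circle> y)) = coset i (x \<circle> y \<oplus> z)" "coset i (x \<circle> (y \<circle> z)) = coset i (x \<circle> y \<oplus> z)"
proof -
  note S = upper_ann_subspace[of i]
  have z: "z \<in> carrier A" using assms upper_ann_closed by blast
  have r: "cong_mod (upper_ann i) w w" if "w \<in> carrier A" for w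
    using cong_mod_refl[OF S that] .
  have 1: "cong_mod (upper_ann i) (z \<circle> w) (w \<oplus> z)" "cong_mod (upper_ann i) (w \<circle> z) (w \<oplus> z)"
    if "w \<in> carrier A" for w
    using circ_upper_ann(1)[of \<zero> w z i] circ_upper_ann(2)[of w \<zero> z i] that z assms(3)
    by (simp_all add: circ_zero_left circ_zero_right del: upper_ann.simps)
  note t = cong_mod_trans[OF _ _ S]
  show "coset i (z \<circle> x) = coset i (x \<oplus> z)" "coset i (x \<circle> z) = coset i (x \<oplus> z)"
    using 1 assms(1) z by (simp_all add: coset_eq_iff del: upper_ann.simps)
  show "coset i ((z \<circle> x) \<circle> y) = coset i (x \<circle> y \<oplus> z)" "coset i ((x \<circle> z) \<circle> y) = coset i (x \<circle> y \<oplus> z)"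
    using t[OF circ_cong[OF 1(1)[OF assms(1)] r[OF assms(2)]] circ_upper_ann(1)[OF assms]]
      t[OF circ_cong[OF 1(2)[OF assms(1)] r[OF assms(2)]] circ_upper_ann(1)[OF assms]] assms(1,2) z
    by (simp_all add: coset_eq_iff del: upper_ann.simps)
  show "coset i (x \<circle> (z \<circle> y)) = coset i (x \<circle> y \<oplus> z)" "coset i (x \<circle> (y \<circle> z)) = coset i (x \<circle> y \<oplus> z)"
    using t[OF circ_cong[OF r[OF assms(1)] 1(1)[OF assms(2)]] circ_upper_ann(2)[OF assms]]
      t[OF circ_cong[OF r[OF assms(1)] 1(2)[OF assms(2)]] circ_upper_ann(2)[OF assms]] assms(1,2) z
    by (simp_all add: coset_eq_iff del: upper_ann.simps)
qed

lemma upper_ann_central: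
  assumes "z \<in> upper_ann (Suc i)"
  shows "upper_ann i #>\<^bsub>Q\<^esub> z \<in> loop_center (Q Mod upper_ann i)"
proof -
  have z: "z \<in> carrier A" using assms upper_ann_closed by blast
  have cosets: "rcosets\<^bsub>Q\<^esub> (upper_ann i) = coset i ` carrier A"
    unfolding RCOSETS_def by (auto simp: upper_ann_coset simp del: upper_ann.simps)
  have "coset i ((x \<circle> y) \<circle> z) = coset i (x \<circle> y \<oplus> z)" "coset i (z \<circle> (x \<circle> y)) = coset i (x \<circle> y \<oplus> z)"
    if "x \<in> carrier A" "y \<in> carrier A" for x y
    using coset_shift[of "x \<circle> y" \<zero> z i] assms that by (simp_all del: upper_ann.simps)
  moreover have "coset i ((x \<oplus> z) \<circle> y) = coset i (x \<circle> y \<oplus> z)"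
    "coset i (x \<circle> (y \<oplus> z)) = coset i (x \<circle> y \<oplus> z)" if "x \<in> carrier A" "y \<in> carrier A" for x y
    using circ_upper_ann[OF that assms] that z by (simp_all add: coset_eq_iff del: upper_ann.simps)
  ultimately show ?thesis
    using z assms unfolding loop_center_def FactGroup_def upper_ann_coset(1)[OF z]
    by (auto simp: cosets coset_set_mult coset_shift simp del: upper_ann.simps)
qed

lemma Q_nilpotent: "nilpotent_loop Q"
proof -
  interpret loop Q by (rule Q_loop)
  have "upper_ann 0 = {\<one>\<^bsub>Q\<^esub>} \<and> upper_ann c = carrier Q \<and>
    (\<forall>i \<le> c. normal_subloop (upper_ann i) Q) \<and>
    (\<forall>i < c. upper_ann i \<subseteq> upper_ann (Suc i) \<and>
      (\<forall>x \<in> upper_ann (Suc i). upper_ann i #>\<^bsub>Q\<^esub> x \<in> loop_center (Q Mod upper_ann i)))"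
    using upper_ann_top upper_ann_normal upper_ann_Suc upper_ann_central by (auto simp del: upper_ann.simps(2))
  then show ?thesis by unfold_locales blast
qed

end

section \<open>Approximation by loop terms\<close>

lemma eval_monomial_letters_cong:
  "(\<And>v. v \<in> letters t \<Longrightarrow> \<rho> v = \<rho>' v) \<Longrightarrow> eval_monomial A \<rho> t = eval_monomial A \<rho>' t"
  by (induction t) auto

text \<open>Evaluation of loop terms with powers replaced by scalar multiples. It makes sense before
  roots are known to exist and is computed componentwise in direct products;
  \<open>eval_term_Q\<close> identifies it with the evaluation in the loop.\<close>

primrec eval_lin ::
  "(rat, 'a) module \<Rightarrow> rat \<Rightarrow> rat \<Rightarrow> rat \<Rightarrow> rat \<Rightarrow> (var monomial \<Rightarrow> rat) \<Rightarrow> (var \<Rightarrow> 'a) \<Rightarrow> loop_term \<Rightarrow> 'a" where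
  "eval_lin A k l m n f \<rho> (Var v) = \<rho> v"
| "eval_lin A k l m n f \<rho> (Op s t) =
     circ A k l m n f (eval_lin A k l m n f \<rho> s) (eval_lin A k l m n f \<rho> t)"
| "eval_lin A k l m n f \<rho> (Pow t q) = q \<odot>\<^bsub>A\<^esub> eval_lin A k l m n f \<rho> t"

section \<open>The degree filtration of the algebra generated by two elements\<close>

context rat_algebra
begin

inductive_set lin_span :: "'a set \<Rightarrow> 'a set" for W where
  base: "w \<in> W \<Longrightarrow> w \<in> lin_span W"
| zero: "\<zero> \<in> lin_span W"
| add: "x \<in> lin_span W \<Longrightarrow> y \<in> lin_span W \<Longrightarrow> x \<oplus> y \<in> lin_span W"
| smult: "x \<in> lin_span W \<Longrightarrow> q \<odot> x \<in> lin_span W"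

lemma lin_span_least:
  assumes "subspace V" "W \<subseteq> V"
  shows "lin_span W \<subseteq> V"
proof
  fix x assume "x \<in> lin_span W"
  then show "x \<in> V" by induction (use assms subspaceD(2-4)[OF assms(1)] in auto)
qed

lemma lin_span_subspace: "W \<subseteq> carrier A \<Longrightarrow> subspace (lin_span W)"
  using lin_span_least[OF subspace_carrier, of W]
  by (auto simp: subspace_def intro: lin_span.intros)

text \<open>For \<open>d = 1\<close> this is the subalgebra generated by the values of
  \<open>\<rho>\<close>; increasing \<open>d\<close> gives a descending filtration of it.\<close>

definition deg_span :: "(var \<Rightarrow> 'a) \<Rightarrow> nat \<Rightarrow> 'a set" where
  "deg_span \<rho> d = lin_span {eval_monomial A \<rho> t | t. monomial_degree t \<ge> d}"

lemma deg_span_mono: "d \<le> e \<Longrightarrow> deg_span \<rho> e \<subseteq> deg_span \<rho> d"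
proof
  fix x assume "d \<le> e" "x \<in> deg_span \<rho> e"
  from this(2) show "x \<in> deg_span \<rho> d"
    unfolding deg_span_def
    by induction (use \<open>d \<le> e\<close> in \<open>auto intro: lin_span.intros dest: order_trans\<close>)
qed

lemma deg_span_trivial:
  assumes "\<And>t. monomial_degree t \<ge> d \<Longrightarrow> eval_monomial A \<rho> t = \<zero>"
  shows "deg_span \<rho> d \<subseteq> {\<zero>}"
  unfolding deg_span_def
  by (rule lin_span_least) (use assms in \<open>auto simp: subspace_def smult_simps\<close>)

end

context anticommutative_rat_algebra
begin

lemma deg_span_subspace: "(\<And>v. \<rho> v \<in> carrier A) \<Longrightarrow> subspace (deg_span \<rho> d)"
  unfolding deg_span_def using eval_monomial_closed by (intro lin_span_subspace) auto

lemma eval_monomial_deg_span: "d \<le> monomial_degree t \<Longrightarrow> eval_monomial A \<rho> t \<in> deg_span \<rho> d"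
  unfolding deg_span_def by (auto intro: lin_span.base)

text \<open>By bilinearity, used in each factor in turn, it suffices to multiply two monomials, and
  degrees of monomials add.\<close>

lemma deg_span_prod:
  assumes \<rho>: "\<And>v. \<rho> v \<in> carrier A" and "x \<in> deg_span \<rho> d" "y \<in> deg_span \<rho> e"
  shows "x \<otimes> y \<in> deg_span \<rho> (d + e)"
proof -
  have S: "subspace (deg_span \<rho> i)" for i by (rule deg_span_subspace) (rule \<rho>)
  have c: "z \<in> lin_span {eval_monomial A \<rho> t | t. monomial_degree t \<ge> i} \<Longrightarrow> z \<in> carrier A" for z i
    using subspaceD(1)[OF S] unfolding deg_span_def .
  have mono: "eval_monomial A \<rho> s \<otimes> y \<in> deg_span \<rho> (d + e)" if s: "d \<le> monomial_degree s" for s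
  proof -
    have ec: "eval_monomial A \<rho> s \<in> carrier A" using \<rho> by (rule eval_monomial_closed)
    from assms(3) show ?thesis
      unfolding deg_span_def[of _ e]
    proof induction
      case (base w)
      then obtain t where "w = eval_monomial A \<rho> t" "e \<le> monomial_degree t" by auto
      then show ?case using s eval_monomial_deg_span[of "d + e" "Prod s t" \<rho>] by simp
    qed (use ec in \<open>auto simp: prod_zero_right prod_add_right prod_smult_right c subspaceD(2-4)[OF S]\<close>)
  qed
  have "y \<in> carrier A" using assms(3) subspaceD(1)[OF S] by blast
  from assms(2) show ?thesis
    unfolding deg_span_def[of _ d]
    by induction (use mono \<open>y \<in> carrier A\<close> in
      \<open>auto simp: prod_zero_left prod_add_left prod_smult_left c subspaceD(2-4)[OF S]\<close>)
qed

end

section \<open>Values of loop terms modulo the degree filtration\<close>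

locale generated_circ_algebra = circ_algebra +
  fixes \<rho> :: "var \<Rightarrow> 'a"
  assumes gen_closed: "\<rho> v \<in> carrier A"
begin

abbreviation G :: "nat \<Rightarrow> 'a set" where "G \<equiv> deg_span \<rho>"

abbreviation tev :: "loop_term \<Rightarrow> 'a" where "tev \<equiv> eval_lin A k l m n f \<rho>"

lemma G_subspace: "subspace (G d)"
  by (rule deg_span_subspace) (rule gen_closed)

lemmas G_zero = subspaceD(2)[OF G_subspace] and G_add = subspaceD(3)[OF G_subspace]
  and G_smult = subspaceD(4)[OF G_subspace]

lemma G_closed: "x \<in> G d \<Longrightarrow> x \<in> carrier A"
  by (rule subspaceD(1)[OF G_subspace])

lemma G_prod: "x \<in> G d \<Longrightarrow> y \<in> G e \<Longrightarrow> x \<otimes> y \<in> G (d + e)"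
  by (rule deg_span_prod) (rule gen_closed)

lemma G_mono: "x \<in> G e \<Longrightarrow> d \<le> e \<Longrightarrow> x \<in> G d"
  using deg_span_mono by blast

lemma G_cong: "cong_mod (G d) x y \<Longrightarrow> y \<in> G d \<Longrightarrow> x \<in> G d"
  using G_add unfolding cong_mod_def by blast

text \<open>In each monomial of \<open>corr\<close> a change of degree \<open>d\<close> is
  multiplied by at least one further factor, which has degree at least 1.\<close>

lemma corr_G:
  assumes "a \<in> G 1" "b \<in> G 1" "a' \<in> G 1" "b' \<in> G 1" "cong_mod (G d) a a'" "cong_mod (G d) b b'"
  shows "cong_mod (G (Suc d)) (corr a b) (corr a' b')"
proof (rule corr_cong[OF G_subspace[of d] G_subspace[of "Suc d"], of "G 1"])
  show "x \<otimes> y \<in> G 1" if "x \<in> G 1" "y \<in> G 1" for x y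
    using G_prod[OF that] G_mono by fastforce
  show "x \<otimes> y \<in> G (Suc d)" if "x \<in> G d" "y \<in> G 1" for x y
    using G_prod[OF that] by simp
qed (use assms G_closed G_mono in auto)

text \<open>Comparison with \<open>corr a \<zero> = \<zero>\<close>. Consequently
  \<open>a \<circle> b\<close> is \<open>a \<oplus> b\<close> modulo degree
  \<open>Suc d\<close>.\<close>

lemma corr_G_right:
  assumes "a \<in> G 1" "b \<in> G d" "d \<ge> 1"
  shows "corr a b \<in> G (Suc d)"
proof -
  have "cong_mod (G d) b \<zero>" using assms(2) cong_mod_zero[OF G_subspace] by blast
  then have "cong_mod (G (Suc d)) (corr a b) (corr a \<zero>)"
    using assms G_mono G_zero cong_mod_refl[OF G_subspace G_closed] by (intro corr_G) blast+
  then show ?thesis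
    using corr_zero_right[OF G_closed[OF assms(1)]] cong_mod_zero[OF G_subspace] by simp
qed

lemma tev_G: "tev t \<in> G 1"
proof (induction t)
  case (Var v)
  then show ?case using eval_monomial_deg_span[of 1 "Letter v" \<rho>] by simp
next
  case (Op s t)
  then have "corr (tev s) (tev t) \<in> G 1" using corr_G_right[of "tev s" "tev t" 1] G_mono by fastforce
  then show ?case using Op G_closed by (simp add: circ_eq G_add)
next
  case (Pow t q)
  then show ?case by (simp add: G_smult)
qed

lemma tev_closed: "tev t \<in> carrier A"
  using tev_G G_closed by blast

text \<open>\<open>i\<close> and \<open>j\<close> count the occurrences of \<open>X\<close> and
  \<open>Y\<close>.\<close>

lemma eval_monomial_weight:
  assumes "u \<in> G d" "v \<in> G e"
  shows "\<exists>i j. i + j = monomial_degree t \<and> eval_monomial A (assign u v) t \<in> G (i * d + j * e) \<and>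
    (X \<in> letters t \<longrightarrow> i \<ge> 1) \<and> (Y \<in> letters t \<longrightarrow> j \<ge> 1)"
proof (induction t)
  case (Letter x)
  show ?case
  proof (cases x)
    case X
    then show ?thesis using assms by (intro exI[of _ 1] exI[of _ 0]) auto
  next
    case Y
    then show ?thesis using assms by (intro exI[of _ 0] exI[of _ 1]) auto
  qed
next
  case (Prod s t)
  then obtain i j i' j' where ij:
    "i + j = monomial_degree s" "eval_monomial A (assign u v) s \<in> G (i * d + j * e)"
    "X \<in> letters s \<longrightarrow> i \<ge> 1" "Y \<in> letters s \<longrightarrow> j \<ge> 1"
    "i' + j' = monomial_degree t" "eval_monomial A (assign u v) t \<in> G (i' * d + j' * e)"
    "X \<in> letters t \<longrightarrow> i' \<ge> 1" "Y \<in> letters t \<longrightarrow> j' \<ge> 1"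
    by blast
  show ?case
    using ij G_prod[OF ij(2,6)]
    by (intro exI[of _ "i + i'"] exI[of _ "j + j'"]) (auto simp: algebra_simps)
qed

text \<open>Monomials in one letter vanish, and a mixed monomial of degree at least 3 has weight at
  least \<open>d + e + min d e\<close>.\<close>

lemma higher_G:
  assumes uv: "u \<in> G d" "v \<in> G e" and de: "d \<ge> 1" "e \<ge> 1"
  shows "higher u v \<in> G (Suc (d + e))"
proof -
  have "eval_monomial A (assign u v) t \<in> G (Suc (d + e))" if "f t \<noteq> 0" for t
  proof (cases "X \<in> letters t \<and> Y \<in> letters t")
    case True
    then obtain i j where ij: "i + j = monomial_degree t"
      "eval_monomial A (assign u v) t \<in> G (i * d + j * e)" "i \<ge> 1" "j \<ge> 1"
      using eval_monomial_weight[OF uv] by blast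
    obtain i' j' where i': "i = Suc i'" "j = Suc j'"
      using ij by (metis One_nat_def Suc_le_D)
    have "i' \<ge> 1 \<or> j' \<ge> 1" using i' ij support_degree[OF that] by linarith
    then have "i' * d + j' * e \<ge> 1" using de by (auto simp: Suc_le_eq)
    then have "Suc (d + e) \<le> i * d + j * e" unfolding i' by simp
    then show ?thesis using ij G_mono by blast
  next
    case False
    have uv1: "u \<in> G 1" "v \<in> G 1" using uv de G_mono by blast+
    \<comment> \<open>At most one variable occurs, so the assignment may be replaced by a constant
      one, whose values all lie on one line.\<close>
    obtain w where w: "w \<in> G 1" "\<And>x. x \<in> letters t \<Longrightarrow> assign u v x = w"
    proof (cases "X \<in> letters t")
      case True
      then have "assign u v x = u" if "x \<in> letters t" for x using False that by (cases x) auto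
      then show ?thesis using that uv1 by blast
    next
      case X: False
      then have "assign u v x = v" if "x \<in> letters t" for x using that by (cases x) auto
      then show ?thesis using that uv1 by blast
    qed
    have wc: "w \<in> carrier A" using w(1) by (rule G_closed)
    have "\<exists>q. w = q \<odot> w" using smult_one_left[OF wc] by metis
    then have "eval_monomial A (\<lambda>_. w) t = \<zero>"
      using eval_monomial_line[OF wc, of "\<lambda>_. w" t] support_degree[OF that] by simp
    then show ?thesis using w G_zero eval_monomial_letters_cong[of t "assign u v" "\<lambda>_. w" A] by simp
  qed
  then show ?thesis
    unfolding higher_def by (intro finsum_subspace finite_support G_subspace) (auto intro: G_smult)
qed

text \<open>A commutator-like term: \<open>u \<circle> v\<close> and \<open>v \<circle> u\<close>
  share the summand \<open>u \<oplus> v\<close> and carry opposite multiples of the product.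
  Dividing one by the other leaves twice \<open>k - l\<close> times the product, which the exponent
  normalises.\<close>

definition prod_term :: "loop_term \<Rightarrow> loop_term \<Rightarrow> loop_term" where
  "prod_term s t = Pow (Op (Op s t) (Pow (Op t s) (-1))) (1 / (2 * (k - l)))"

lemma prod_term_G:
  assumes u: "tev s \<in> G d" and v: "tev t \<in> G e" and de: "d \<ge> 1" "e \<ge> 1" and kl: "k \<noteq> l"
  shows "cong_mod (G (Suc (d + e))) (tev (prod_term s t)) (tev s \<otimes> tev t)"
proof -
  let ?u = "tev s" and ?v = "tev t" and ?J = "G (Suc (d + e))" and ?I = "G (d + e)"
  note [simp] = tev_closed
  note J = G_subspace[of "Suc (d + e)"] and I = G_subspace[of "d + e"]
  define p where "p = ?u \<oplus> ?v"
  define r where "r = (k - l) \<odot> (?u \<otimes> ?v)"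
  define a where "a = ?u \<circle> ?v"
  define b where "b = (-1) \<odot> (?v \<circle> ?u)"
  have c [simp]: "p \<in> carrier A" "r \<in> carrier A" "a \<in> carrier A" "b \<in> carrier A"
    by (simp_all add: p_def r_def a_def b_def)
  have rI: "r \<in> ?I" unfolding r_def using G_prod[OF u v] by (rule G_smult)
  have a1: "a \<in> G 1" using tev_G[of "Op s t"] by (simp add: a_def)
  have b1: "b \<in> G 1" using tev_G[of "Pow (Op t s) (-1)"] by (simp add: b_def)
  have "a = (p \<oplus> r) \<oplus> higher ?u ?v"
    unfolding a_def p_def r_def by (simp add: circ_eq corr_def a_assoc)
  then have aJ: "cong_mod ?J a (p \<oplus> r)"
    using cong_mod_add_right[OF J, of "p \<oplus> r"] higher_G[OF u v de] by simp
  have "b = ((-1) \<odot> p \<oplus> r) \<oplus> (-1) \<odot> higher ?v ?u"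
    unfolding b_def p_def r_def
    by (simp add: circ_eq corr_def a_ac smult_simps anticomm[of ?u ?v])
  then have bJ: "cong_mod ?J b ((-1) \<odot> p \<oplus> r)"
    using cong_mod_add_right[OF J, of "(-1) \<odot> p \<oplus> r" "(-1) \<odot> higher ?v ?u"] higher_G[OF v u de(2,1)]
    by (simp add: G_smult add.commute)
  have JI: "?J \<subseteq> ?I" using G_mono by fastforce
  have aI: "cong_mod ?I a p"
    using cong_mod_trans[OF cong_mod_mono[OF aJ JI] cong_mod_add_right[OF I _ rI] I] by simp
  have bI: "cong_mod ?I b ((-1) \<odot> p)"
    using cong_mod_trans[OF cong_mod_mono[OF bJ JI] cong_mod_add_right[OF I _ rI] I] by simp
  \<comment> \<open>The decisive cancellation: \<open>b\<close> is the negative of \<open>a\<close>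
    modulo degree \<open>d + e\<close>, so \<open>corr a b\<close> agrees modulo one degree more
    with \<open>corr a ((-1) \<odot> a)\<close>, which vanishes because its arguments lie on a
    line.\<close>
  have "cong_mod ?I b ((-1) \<odot> a)"
    using cong_mod_trans[OF bI cong_mod_smult[OF I cong_mod_sym[OF I aI]] I] .
  then have "cong_mod ?J (corr a b) (corr a ((-1) \<odot> a))"
    using a1 b1 by (intro corr_G cong_mod_refl G_smult I) simp_all
  moreover have "corr a ((-1) \<odot> a) = \<zero>" using corr_line[of a 1 "-1"] by (simp add: smult_one_left)
  ultimately have "cong_mod ?J (corr a b) \<zero>" by simp
  from cong_mod_add[OF J cong_mod_add[OF J aJ bJ] this]
  have "cong_mod ?J (a \<circle> b) ((p \<oplus> r) \<oplus> ((-1) \<odot> p \<oplus> r))"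
    by (simp add: circ_eq)
  also have "(p \<oplus> r) \<oplus> ((-1) \<odot> p \<oplus> r) = (p \<oplus> (-1) \<odot> p) \<oplus> (r \<oplus> r)"
    by (simp only: a_ac a_closed c smult_closed rat_field_simps UNIV_I)
  also have "\<dots> = 2 \<odot> r" using smult_add_left[of r 1 1] by (simp add: add_neg smult_one_left)
  finally have "cong_mod ?J ((1 / (2 * (k - l))) \<odot> (a \<circle> b)) ((1 / (2 * (k - l))) \<odot> (2 \<odot> r))"
    by (rule cong_mod_smult[OF J])
  then show ?thesis
    using kl by (simp add: prod_term_def a_def b_def r_def smult_smult smult_one_left)
qed

text \<open>An error one degree above a factor remains one degree above the product after
  multiplication, so the approximations of the two factors can be fed into
  \<open>prod_term\<close>.\<close>

lemma monomial_approx: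
  assumes "k \<noteq> l"
  shows "\<exists>s. cong_mod (G (Suc (monomial_degree t))) (eval_monomial A \<rho> t) (tev s)"
proof (induction t)
  case (Letter v)
  show ?case using cong_mod_refl[OF G_subspace gen_closed] by (auto intro!: exI[of _ "Var v"])
next
  case (Prod t1 t2)
  let ?d1 = "monomial_degree t1" and ?d2 = "monomial_degree t2"
  let ?e1 = "eval_monomial A \<rho> t1" and ?e2 = "eval_monomial A \<rho> t2"
  let ?J = "G (Suc (?d1 + ?d2))"
  note J = G_subspace[of "Suc (?d1 + ?d2)"]
  obtain s1 s2 where s: "cong_mod (G (Suc ?d1)) ?e1 (tev s1)" "cong_mod (G (Suc ?d2)) ?e2 (tev s2)"
    using Prod by blast
  then obtain x1 x2 where x: "x1 \<in> G (Suc ?d1)" "tev s1 = ?e1 \<oplus> x1" "x2 \<in> G (Suc ?d2)" "tev s2 = ?e2 \<oplus> x2"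
    using cong_mod_sym[OF G_subspace] unfolding cong_mod_def by meson
  have e: "?e1 \<in> G ?d1" "?e2 \<in> G ?d2" by (simp_all add: eval_monomial_deg_span)
  have g: "tev s1 \<in> G ?d1" "tev s2 \<in> G ?d2"
    using e x G_mono by (simp_all add: G_add)
  have "tev s1 \<otimes> tev s2 = ?e1 \<otimes> ?e2 \<oplus> (?e1 \<otimes> x2 \<oplus> x1 \<otimes> tev s2)"
    unfolding x(2,4) using e x G_closed by (intro prod_add_add) blast+
  moreover have "?e1 \<otimes> x2 \<oplus> x1 \<otimes> tev s2 \<in> ?J"
    using G_add[OF G_prod[OF e(1) x(3)], of "x1 \<otimes> tev s2"] G_prod[OF x(1) g(2)] by simp
  ultimately have "cong_mod ?J (tev s1 \<otimes> tev s2) (?e1 \<otimes> ?e2)"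
    using cong_mod_add_right[OF J, of "?e1 \<otimes> ?e2"] e G_closed by simp
  from cong_mod_trans[OF prod_term_G[OF g _ _ assms] this J]
  have "cong_mod ?J (tev (prod_term s1 s2)) (?e1 \<otimes> ?e2)" by (simp add: monomial_degree_pos[simplified])
  from cong_mod_sym[OF J this] show ?case by auto
qed

text \<open>Passes from monomials to their linear combinations: \<open>Op\<close> realises sums,
  since its correction lies in degree \<open>Suc d\<close>, and \<open>Pow\<close> realises scalar
  multiples.\<close>

lemma G_approx:
  assumes "k \<noteq> l" "d \<ge> 1" "z \<in> G d"
  shows "\<exists>s. cong_mod (G (Suc d)) z (tev s)"
proof -
  note S = G_subspace[of "Suc d"]
  have *: "x \<in> lin_span {eval_monomial A \<rho> t |t. d \<le> monomial_degree t} \<longleftrightarrow> x \<in> G d" for x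
    by (simp add: deg_span_def)
  from assms(3) show ?thesis
    unfolding deg_span_def[of _ d]
  proof induction
    case (base w)
    then obtain t where t: "w = eval_monomial A \<rho> t" "d \<le> monomial_degree t" by auto
    then show ?case using monomial_approx[OF assms(1), of t] cong_mod_mono[OF _ deg_span_mono[of "Suc d"]]
      by blast
  next
    case zero
    have "cong_mod (G (Suc d)) \<zero> (tev (Pow (Var X) 0))"
      using cong_mod_refl[OF S] gen_closed by (simp add: smult_zero_left)
    then show ?case by blast
  next
    case (add x y)
    then obtain s t where st: "cong_mod (G (Suc d)) x (tev s)" "cong_mod (G (Suc d)) y (tev t)" by blast
    have g: "tev t \<in> G d"
      using G_cong[of d "tev t" y] cong_mod_sym[OF S st(2)] cong_mod_mono[OF _ deg_span_mono[of d "Suc d"]]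
        add(2) * by simp
    have "corr (tev s) (tev t) \<in> G (Suc d)" using corr_G_right[OF tev_G g assms(2)] .
    then have "cong_mod (G (Suc d)) (tev (Op s t)) (tev s \<oplus> tev t)"
      using cong_mod_add_right[OF S] tev_closed by (simp add: circ_eq)
    from cong_mod_trans[OF cong_mod_add[OF S st] cong_mod_sym[OF S this] S] show ?case by blast
  next
    case (smult x q)
    then obtain s where "cong_mod (G (Suc d)) x (tev s)" by blast
    then have "cong_mod (G (Suc d)) (q \<odot> x) (tev (Pow s q))" using cong_mod_smult[OF S] by simp
    then show ?case by blast
  qed
qed

theorem G_term:
  assumes kl: "k \<noteq> l" and nil: "G N \<subseteq> {\<zero>}" and z: "z \<in> G 1"
  shows "\<exists>t. z = tev t"
proof -
  have "\<exists>t. cong_mod (G (Suc i)) z (tev t)" for i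
  proof (induction i)
    case 0
    \<comment> \<open>Degree 1 is the whole generated subalgebra, so zero, written as a zeroth
      power, is a first approximation.\<close>
    have "cong_mod (G 1) z (tev (Pow (Var X) 0))"
      using cong_mod_zero[OF G_subspace] z gen_closed by (simp add: smult_zero_left)
    then show ?case unfolding One_nat_def by blast
  next
    case (Suc i)
    let ?d = "Suc i"
    note S = G_subspace[of "Suc ?d"]
    obtain t x where t: "x \<in> G ?d" "z = tev t \<oplus> x" using Suc unfolding cong_mod_def by blast
    \<comment> \<open>The remaining error \<open>x\<close> is approximated by a term of its own,
      which is then appended to \<open>t\<close> by the loop operation.\<close>
    obtain s where s: "cong_mod (G (Suc ?d)) x (tev s)" using G_approx[OF kl _ t(1)] by auto
    have g: "tev s \<in> G ?d"
      using G_cong[of ?d "tev s" x] cong_mod_sym[OF S s] cong_mod_mono[OF _ deg_span_mono[of ?d "Suc ?d"]]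
        t(1) by simp
    have "corr (tev t) (tev s) \<in> G (Suc ?d)" using corr_G_right[OF tev_G g] by simp
    then have "cong_mod (G (Suc ?d)) (tev (Op t s)) (tev t \<oplus> tev s)"
      using cong_mod_add_right[OF S] tev_closed by (simp add: circ_eq)
    from cong_mod_trans[OF cong_mod_add[OF S cong_mod_refl[OF S tev_closed] s] cong_mod_sym[OF S this] S]
    show ?case using t(2) by blast
  qed
  then obtain t where "cong_mod (G (Suc N)) z (tev t)" by blast
  moreover have "G (Suc N) \<subseteq> {\<zero>}"
    using deg_span_mono[of N "Suc N" \<rho>] nil by simp
  ultimately have "cong_mod {\<zero>} z (tev t)" by (rule cong_mod_mono)
  then show ?thesis using cong_mod_trivial by blast
qed

end

section \<open>Uniformity and reconstruction\<close>

lemma eval_monomial_map: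
  "eval_monomial A \<rho> t = eval_monomial A id (map_monomial \<rho> t)"
  "monomial_degree (map_monomial \<rho> t) = monomial_degree t"
  by (induction t) auto

section \<open>Vanishing of monomials above the nilpotency class\<close>

context rat_algebra
begin

text \<open>Some subterm is a product of two letters; replacing it by the single letter that is
  their product keeps the value and lowers the degree by one.\<close>

lemma contract_monomial:
  assumes "letters t \<subseteq> carrier A" "monomial_degree t \<ge> 2"
  shows "\<exists>t'. letters t' \<subseteq> carrier A \<and> Suc (monomial_degree t') = monomial_degree t \<and>
    eval_monomial A id t' = eval_monomial A id t"
  using assms
proof (induction t)
  case (Letter v)
  then show ?case by simp
next
  case (Prod s t)
  have deg: "monomial_degree u \<ge> 2 \<or> (\<exists>a. u = Letter a)" for u :: "'a monomial"
  proof (cases u)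
    case (Prod u1 u2)
    have "monomial_degree w \<ge> 1" for w :: "'a monomial" by (induction w) auto
    from this[of u1] this[of u2] show ?thesis using Prod by simp
  qed simp
  consider "monomial_degree s \<ge> 2" | "monomial_degree t \<ge> 2" | a b where "s = Letter a" "t = Letter b"
    using deg by blast
  then show ?case
  proof cases
    case 1
    then obtain s' where "letters s' \<subseteq> carrier A" "Suc (monomial_degree s') = monomial_degree s"
      "eval_monomial A id s' = eval_monomial A id s"
      using Prod by (auto simp: id_def)
    then show ?thesis using Prod.prems by (intro exI[of _ "Prod s' t"]) (auto simp: id_def)
  next
    case 2
    then obtain t' where "letters t' \<subseteq> carrier A" "Suc (monomial_degree t') = monomial_degree t"
      "eval_monomial A id t' = eval_monomial A id t"
      using Prod by (auto simp: id_def)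
    then show ?thesis using Prod.prems by (intro exI[of _ "Prod s t'"]) (auto simp: id_def)
  next
    case 3
    then show ?thesis using Prod.prems by (intro exI[of _ "Letter (a \<otimes> b)"]) auto
  qed
qed

text \<open>The nilpotency condition speaks of degree exactly \<open>c + 1\<close>; larger degrees
  are brought down to it by repeated contraction.\<close>

lemma nilpotent_eval_zero:
  assumes nil: "nilpotent_of_class A c" and \<rho>: "\<And>v. \<rho> v \<in> carrier A" and deg: "monomial_degree t > c"
  shows "eval_monomial A \<rho> t = \<zero>"
proof -
  have "eval_monomial A id u = \<zero>" if "letters u \<subseteq> carrier A" "monomial_degree u = Suc (c + j)" for u j
    using that
  proof (induction j arbitrary: u)
    case 0
    then show ?case using nil unfolding nilpotent_of_class_def by (simp add: id_def)
  next
    case (Suc j)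
    obtain u' where "letters u' \<subseteq> carrier A" "monomial_degree u' = Suc (c + j)"
      "eval_monomial A id u' = eval_monomial A id u"
      using contract_monomial[of u] Suc.prems by auto
    then show ?case using Suc.IH by metis
  qed
  from this[of "map_monomial \<rho> t" "monomial_degree t - Suc c"] show ?thesis
    using \<rho> deg unfolding eval_monomial_map(1)[of _ \<rho>] by (auto simp: eval_monomial_map(2) monomial.set_map)
qed

end

section \<open>Direct products of algebras and uniform terms\<close>

definition algebra_product :: "('i \<Rightarrow> (rat, 'a) module) \<Rightarrow> (rat, 'i \<Rightarrow> 'a) module" where
  "algebra_product C = \<lparr>carrier = {\<phi>. \<forall>i. \<phi> i \<in> carrier (C i)},
     mult = (\<lambda>\<phi> \<psi> i. \<phi> i \<otimes>\<^bsub>C i\<^esub> \<psi> i), one = (\<lambda>i. \<one>\<^bsub>C i\<^esub>), zero = (\<lambda>i. \<zero>\<^bsub>C i\<^esub>),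
     add = (\<lambda>\<phi> \<psi> i. \<phi> i \<oplus>\<^bsub>C i\<^esub> \<psi> i), smult = (\<lambda>q \<phi> i. q \<odot>\<^bsub>C i\<^esub> \<phi> i)\<rparr>"

lemma algebra_product_simps [simp]:
  "\<phi> \<in> carrier (algebra_product C) \<longleftrightarrow> (\<forall>i. \<phi> i \<in> carrier (C i))"
  "(\<phi> \<otimes>\<^bsub>algebra_product C\<^esub> \<psi>) i = \<phi> i \<otimes>\<^bsub>C i\<^esub> \<psi> i"
  "\<zero>\<^bsub>algebra_product C\<^esub> i = \<zero>\<^bsub>C i\<^esub>"
  "(\<phi> \<oplus>\<^bsub>algebra_product C\<^esub> \<psi>) i = \<phi> i \<oplus>\<^bsub>C i\<^esub> \<psi> i"
  "(q \<odot>\<^bsub>algebra_product C\<^esub> \<phi>) i = q \<odot>\<^bsub>C i\<^esub> \<phi> i"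
  by (simp_all add: algebra_product_def)

lemma algebra_product_anticommutative:
  assumes "\<And>i. anticommutative_rat_algebra (C i)"
  shows "anticommutative_rat_algebra (algebra_product C)"
proof -
  interpret C: anticommutative_rat_algebra "C i" for i by (rule assms)
  have "abelian_group (algebra_product C)"
  proof (rule abelian_groupI)
    fix \<phi> assume "\<phi> \<in> carrier (algebra_product C)"
    then have "(\<lambda>i. \<ominus>\<^bsub>C i\<^esub> \<phi> i) \<in> carrier (algebra_product C) \<and>
        (\<lambda>i. \<ominus>\<^bsub>C i\<^esub> \<phi> i) \<oplus>\<^bsub>algebra_product C\<^esub> \<phi> = \<zero>\<^bsub>algebra_product C\<^esub>"
      by (auto simp: fun_eq_iff C.l_neg)
    then show "\<exists>\<psi>\<in>carrier (algebra_product C). \<psi> \<oplus>\<^bsub>algebra_product C\<^esub> \<phi> = \<zero>\<^bsub>algebra_product C\<^esub>"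
      by blast
  qed (auto simp: fun_eq_iff C.a_ac)
  then have "module rat_field (algebra_product C)"
    using C.is_cring
    by (intro moduleI) (auto simp: fun_eq_iff C.smult_add_left C.smult_add_right C.smult_smult C.smult_one_left)
  then show ?thesis
    by (intro anticommutative_rat_algebra.intro rat_algebra.intro rat_algebra_axioms.intro
        anticommutative_rat_algebra_axioms.intro)
      (auto simp: fun_eq_iff C.prod_add_left C.prod_add_right C.prod_smult_left C.prod_smult_right C.prod_square)
qed

lemma eval_monomial_product:
  "eval_monomial (algebra_product C) \<rho> t i = eval_monomial (C i) (\<lambda>v. \<rho> v i) t"
  by (induction t) auto

lemma finsum_product:
  assumes "\<And>i. anticommutative_rat_algebra (C i)" "finite S"
    "\<And>t. t \<in> S \<Longrightarrow> p t \<in> carrier (algebra_product C)"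
  shows "finsum (algebra_product C) p S i = (\<Oplus>\<^bsub>C i\<^esub>t\<in>S. p t i)"
  using assms(2,3)
proof (induction S rule: finite_induct)
  interpret C: anticommutative_rat_algebra "C i" for i by (rule assms)
  interpret P: anticommutative_rat_algebra "algebra_product C"
    by (rule algebra_product_anticommutative) (rule assms)
  {
    case empty
    then show ?case by simp
  next
    case (insert t S)
    then have "p \<in> S \<rightarrow> carrier (algebra_product C)" "(\<lambda>t. p t i) \<in> S \<rightarrow> carrier (C i)" by auto
    then show ?case using insert by simp
  }
qed

lemma circ_product:
  assumes C: "\<And>i. circ_algebra (C i) f"
    and "\<phi> \<in> carrier (algebra_product C)" "\<psi> \<in> carrier (algebra_product C)"
  shows "circ (algebra_product C) k l m n f \<phi> \<psi> i = circ (C i) k l m n f (\<phi> i) (\<psi> i)"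
proof -
  interpret C: circ_algebra "C i" k l m n f for i by (rule C)
  have assign: "(\<lambda>v. assign \<phi> \<psi> v i) = assign (\<phi> i) (\<psi> i)" for i
    by (rule ext) (metis assign.simps var.exhaust)
  have "eval_monomial (C i) (assign (\<phi> i) (\<psi> i)) t \<in> carrier (C i)" for t i
    using assms(2,3) by (intro C.eval_monomial_closed C.assign_in) auto
  then show ?thesis
    unfolding circ_def
    by (simp add: finsum_product[OF C.anticommutative_rat_algebra_axioms C.finite_support]
        eval_monomial_product assign)
qed

lemma eval_lin_product:
  assumes C: "\<And>i. circ_algebra (C i) f" and \<rho>: "\<And>v. \<rho> v \<in> carrier (algebra_product C)"
  shows "eval_lin (algebra_product C) k l m n f \<rho> t \<in> carrier (algebra_product C) \<and>
    (\<forall>i. eval_lin (algebra_product C) k l m n f \<rho> t i = eval_lin (C i) k l m n f (\<lambda>v. \<rho> v i) t)"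
proof -
  interpret C: circ_algebra "C i" k l m n f for i by (rule C)
  show ?thesis
  proof (induction t)
    case (Op s t)
    then show ?case by (auto simp: circ_product[OF C])
  qed (use \<rho> in auto)
qed

text \<open>A term that works for all algebras of the family and all pairs of elements at once is found
  by evaluating in the product algebra, at the tautological pair of generators.\<close>

theorem uniform_term:
  fixes C :: "'j \<Rightarrow> (rat, 'a) module"
  assumes C: "\<And>j. circ_algebra (C j) f" and nil: "\<And>j. nilpotent_of_class (C j) (c j)"
    and c: "\<And>j. c j \<le> N" and kl: "k \<noteq> l"
  obtains S T where
    "\<And>j a b. a \<in> carrier (C j) \<Longrightarrow> b \<in> carrier (C j) \<Longrightarrow>
      a \<oplus>\<^bsub>C j\<^esub> b = eval_lin (C j) k l m n f (assign a b) S"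
    "\<And>j a b. a \<in> carrier (C j) \<Longrightarrow> b \<in> carrier (C j) \<Longrightarrow>
      a \<otimes>\<^bsub>C j\<^esub> b = eval_lin (C j) k l m n f (assign a b) T"
proof -
  \<comment> \<open>One component for each algebra together with each pair of elements. Pairs
    outside the carrier get zero entries in \<open>x\<close> and \<open>y\<close>, which keeps both
    inside the product.\<close>
  define D :: "'j \<times> 'a \<times> 'a \<Rightarrow> (rat, 'a) module" where "D = (\<lambda>(j, _). C j)"
  define x :: "'j \<times> 'a \<times> 'a \<Rightarrow> 'a" where
    "x = (\<lambda>(j, a, b). if a \<in> carrier (C j) then a else \<zero>\<^bsub>C j\<^esub>)"
  define y :: "'j \<times> 'a \<times> 'a \<Rightarrow> 'a" where
    "y = (\<lambda>(j, a, b). if b \<in> carrier (C j) then b else \<zero>\<^bsub>C j\<^esub>)"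
  have D: "circ_algebra (D i) f" for i using C by (auto simp: D_def split: prod.split)
  interpret D: circ_algebra "D i" k l m n f for i by (rule D)
  let ?P = "algebra_product D"
  have xy: "x \<in> carrier ?P" "y \<in> carrier ?P"
    using D.zero_closed by (auto simp: x_def y_def D_def split: prod.splits)
  interpret P: generated_circ_algebra ?P k l m n f "assign x y"
  proof (intro generated_circ_algebra.intro circ_algebra.intro circ_algebra_axioms.intro
      generated_circ_algebra_axioms.intro algebra_product_anticommutative)
    show "assign x y v \<in> carrier ?P" for v using xy by (cases v) auto
  qed (use D.anticommutative_rat_algebra_axioms D.finite_support D.support_degree in auto)
  \<comment> \<open>The common bound \<open>N\<close> on the nilpotency classes makes the filtration
    of the possibly infinite product terminate.\<close>
  have "P.G (Suc N) \<subseteq> {\<zero>\<^bsub>?P\<^esub>}"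
  proof (rule P.deg_span_trivial)
    fix t :: "var monomial" assume t: "Suc N \<le> monomial_degree t"
    have "eval_monomial (D i) (\<lambda>v. assign x y v i) t = \<zero>\<^bsub>D i\<^esub>" for i
    proof (rule D.nilpotent_eval_zero)
      show "nilpotent_of_class (D i) (c (fst i))" using nil by (auto simp: D_def split: prod.split)
      show "assign x y v i \<in> carrier (D i)" for v using P.gen_closed[of v] by (simp only: algebra_product_simps)
      show "c (fst i) < monomial_degree t" using t c[of "fst i"] by simp
    qed
    then show "eval_monomial ?P (assign x y) t = \<zero>\<^bsub>?P\<^esub>"
      by (simp add: fun_eq_iff eval_monomial_product)
  qed
  note attained = P.G_term[OF kl this]
  have gen: "x \<in> P.G 1" "y \<in> P.G 1"
    using P.tev_G[of "Var X"] P.tev_G[of "Var Y"] by simp_all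
  have "x \<otimes>\<^bsub>?P\<^esub> y \<in> P.G 1" using P.G_prod[OF gen] P.G_mono by fastforce
  then obtain S T where S: "x \<oplus>\<^bsub>?P\<^esub> y = P.tev S" and T: "x \<otimes>\<^bsub>?P\<^esub> y = P.tev T"
    using attained P.G_add[OF gen] by meson
  have tev: "P.tev t (j, a, b) = eval_lin (C j) k l m n f (assign a b) t"
    if "a \<in> carrier (C j)" "b \<in> carrier (C j)" for t j a b
  proof -
    have "(\<lambda>v. assign x y v (j, a, b)) = assign a b"
      using that by (intro ext) (metis (mono_tags, lifting) assign.simps case_prod_conv var.exhaust x_def y_def)
    then show ?thesis
      using eval_lin_product[where t = t, OF D P.gen_closed] by (simp add: D_def)
  qed
  show thesis
  proof
    fix j a b assume ab: "a \<in> carrier (C j)" "b \<in> carrier (C j)"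
    show "a \<oplus>\<^bsub>C j\<^esub> b = eval_lin (C j) k l m n f (assign a b) S"
      using fun_cong[OF S, of "(j, a, b)"] ab unfolding tev[OF ab] by (simp add: x_def y_def D_def)
    show "a \<otimes>\<^bsub>C j\<^esub> b = eval_lin (C j) k l m n f (assign a b) T"
      using fun_cong[OF T, of "(j, a, b)"] ab unfolding tev[OF ab] by (simp add: x_def y_def D_def)
  qed
qed

section \<open>Return to the loop, and uniqueness of the reconstruction\<close>

lemma (in nilpotent_circ_algebra) eval_term_Q:
  assumes "\<And>v. \<rho> v \<in> carrier A"
  shows "eval_lin A k l m n f \<rho> t \<in> carrier A \<and> eval_term Q \<rho> t = eval_lin A k l m n f \<rho> t"
  by (induction t) (auto simp: assms Q_rat_pow)

lemma nilpotent_circ_algebraI: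
  assumes "anticommutative_rat_algebra A" "nilpotent_of_class A c"
    "finite {t. f t \<noteq> 0}" "\<forall>t. f t \<noteq> 0 \<longrightarrow> monomial_degree t \<ge> 3"
  shows "nilpotent_circ_algebra A f c"
proof -
  interpret anticommutative_rat_algebra A by fact
  interpret circ_algebra A k l m n f for k l m n by unfold_locales (use assms in auto)
  have "upper_ann c = carrier A"
    using assms(2) unfolding nilpotent_of_class_def by (intro upper_ann_eq_carrier) blast
  then show ?thesis by unfold_locales
qed

text \<open>Zero is the neutral element of \<open>\<circle>\<close>, natural multiples are its
  powers, negatives its inverses, and fractions arise by division. Thus \<open>eval_lin\<close>,
  which uses the scalars of its algebra, takes the same values in both algebras.\<close>

lemma smult_determined_by_circ:
  assumes "nilpotent_circ_algebra A f c" "nilpotent_circ_algebra B f d"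
    and carrier: "carrier B = carrier A"
    and eq: "\<And>a b. a \<in> carrier A \<Longrightarrow> b \<in> carrier A \<Longrightarrow> circ B k l m n f a b = circ A k l m n f a b"
    and a: "a \<in> carrier A"
  shows "q \<odot>\<^bsub>B\<^esub> a = q \<odot>\<^bsub>A\<^esub> a"
proof -
  interpret A: nilpotent_circ_algebra A k l m n f c by fact
  interpret B: nilpotent_circ_algebra B k l m n f d by fact
  \<comment> \<open>The zero of \<open>B\<close> is idempotent for the common operation; in
    \<open>A\<close>, left cancellation forces it to be the zero of \<open>A\<close>.\<close>
  have zero: "\<zero>\<^bsub>B\<^esub> = \<zero>\<^bsub>A\<^esub>"
  proof (rule A.circ_left_inj[of "\<zero>\<^bsub>B\<^esub>"])
    show "circ A k l m n f \<zero>\<^bsub>B\<^esub> \<zero>\<^bsub>B\<^esub> = circ A k l m n f \<zero>\<^bsub>B\<^esub> \<zero>\<^bsub>A\<^esub>"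
      using B.circ_zero_left[of "\<zero>\<^bsub>B\<^esub>"] B.zero_closed A.circ_zero_right eq carrier by auto
  qed (use B.zero_closed carrier in auto)
  have cl: "r \<odot>\<^bsub>B\<^esub> x \<in> carrier A" "r \<odot>\<^bsub>A\<^esub> x \<in> carrier A" if "x \<in> carrier A" for r x
    using that B.smult_closed[of r x] carrier by auto
  have nat: "of_nat i \<odot>\<^bsub>B\<^esub> x = of_nat i \<odot>\<^bsub>A\<^esub> x" if x: "x \<in> carrier A" for i x
  proof (induction i)
    case 0
    then show ?case using x zero carrier by (simp add: A.smult_zero_left B.smult_zero_left)
  next
    case (Suc i)
    have "of_nat (Suc i) \<odot>\<^bsub>B\<^esub> x = circ B k l m n f (of_nat i \<odot>\<^bsub>B\<^esub> x) x"
      using x carrier B.circ_line[of x "of_nat i" 1] by (simp add: B.smult_one_left add.commute)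
    also have "\<dots> = circ A k l m n f (of_nat i \<odot>\<^bsub>A\<^esub> x) x"
      using Suc x cl by (simp add: eq)
    also have "\<dots> = of_nat (Suc i) \<odot>\<^bsub>A\<^esub> x"
      using x A.circ_line[of x "of_nat i" 1] by (simp add: A.smult_one_left add.commute)
    finally show ?case .
  qed
  have neg: "(-1) \<odot>\<^bsub>B\<^esub> x = (-1) \<odot>\<^bsub>A\<^esub> x" if x: "x \<in> carrier A" for x
  proof (rule A.circ_left_inj[OF x cl[OF x]])
    have "circ A k l m n f x ((-1) \<odot>\<^bsub>B\<^esub> x) = circ B k l m n f x ((-1) \<odot>\<^bsub>B\<^esub> x)"
      using x cl by (simp add: eq)
    also have "\<dots> = circ A k l m n f x ((-1) \<odot>\<^bsub>A\<^esub> x)"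
      using x carrier zero A.circ_line[of x 1 "-1"] B.circ_line[of x 1 "-1"]
      by (simp add: A.smult_one_left B.smult_one_left A.smult_zero_left B.smult_zero_left)
    finally show "circ A k l m n f x ((-1) \<odot>\<^bsub>B\<^esub> x) = circ A k l m n f x ((-1) \<odot>\<^bsub>A\<^esub> x)" .
  qed
  have int: "of_int i \<odot>\<^bsub>B\<^esub> x = of_int i \<odot>\<^bsub>A\<^esub> x" if x: "x \<in> carrier A" for i x
  proof (cases i rule: int_cases2)
    case (nonneg j)
    then show ?thesis using nat[OF x, of j] by simp
  next
    case (nonpos j)
    have "(-1) \<odot>\<^bsub>B\<^esub> (of_nat j \<odot>\<^bsub>B\<^esub> x) = (-1) \<odot>\<^bsub>A\<^esub> (of_nat j \<odot>\<^bsub>A\<^esub> x)"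
      using neg[OF cl(2)[OF x]] nat[OF x] by simp
    then show ?thesis using nonpos x carrier by (simp add: A.smult_smult B.smult_smult)
  qed
  obtain s t where st: "quotient_of q = (s, t)" by fastforce
  then have t: "t \<noteq> 0" "q = of_int s / of_int t"
    using quotient_of_denom_pos[OF st] quotient_of_div[OF st] by auto
  \<comment> \<open>Integer multiples already agree in both algebras, so the two candidates are
    compared after multiplication by the denominator.\<close>
  have "of_int t \<odot>\<^bsub>A\<^esub> (q \<odot>\<^bsub>B\<^esub> a) = of_int t \<odot>\<^bsub>B\<^esub> (q \<odot>\<^bsub>B\<^esub> a)"
    using int[OF cl(1)[OF a]] by simp
  also have "\<dots> = of_int s \<odot>\<^bsub>A\<^esub> a" using int[OF a, of s] a carrier t by (simp add: B.smult_smult)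
  finally have "(1 / of_int t) \<odot>\<^bsub>A\<^esub> (of_int t \<odot>\<^bsub>A\<^esub> (q \<odot>\<^bsub>B\<^esub> a)) = (1 / of_int t) \<odot>\<^bsub>A\<^esub> (of_int s \<odot>\<^bsub>A\<^esub> a)"
    by simp
  then show ?thesis using t a cl(1)[OF a, of q] by (simp add: A.smult_smult A.smult_one_left)
qed

theorem theorem2p7:
  fixes A :: "(rat, 'a) module" and c :: nat and k l m n :: rat
    and f :: "var monomial \<Rightarrow> rat"
  assumes "anticommutative_rat_algebra A"
    and "nilpotent_of_class A c" and "c \<ge> 2"
    and "k \<noteq> l"
    and "finite {t. f t \<noteq> 0}" and "\<forall>t. f t \<noteq> 0 \<longrightarrow> monomial_degree t \<ge> 3"
  shows "uniquely_divisible_loop (loop_of A k l m n f) \<and>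
    nilpotent_loop (loop_of A k l m n f) \<and>
    (\<exists>S T. \<forall>a \<in> carrier A. \<forall>b \<in> carrier A.
       a \<oplus>\<^bsub>A\<^esub> b = eval_term (loop_of A k l m n f) (assign a b) S \<and>
       a \<otimes>\<^bsub>A\<^esub> b = eval_term (loop_of A k l m n f) (assign a b) T) \<and>
    (\<forall>(B :: (rat, 'a) module) d.
       anticommutative_rat_algebra B \<and> nilpotent_of_class B d \<and>
       carrier B = carrier A \<and>
       (\<forall>a \<in> carrier A. \<forall>b \<in> carrier A. circ B k l m n f a b = circ A k l m n f a b) \<longrightarrow>
       (\<forall>a \<in> carrier A. \<forall>b \<in> carrier A. a \<oplus>\<^bsub>B\<^esub> b = a \<oplus>\<^bsub>A\<^esub> b \<and> a \<otimes>\<^bsub>B\<^esub> b = a \<otimes>\<^bsub>A\<^esub> b))"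
proof -
  have A: "nilpotent_circ_algebra A f c"
    by (rule nilpotent_circ_algebraI) (use assms in auto)
  interpret A: nilpotent_circ_algebra A k l m n f c by (rule A)
  have lin_closed: "eval_lin A k l m n f (assign a b) t \<in> carrier A"
    and lin: "eval_term A.Q (assign a b) t = eval_lin A k l m n f (assign a b) t"
    if "a \<in> carrier A" "b \<in> carrier A" for a b t
    using A.eval_term_Q[of "assign a b" t] A.assign_in[OF that] by auto
  \<comment> \<open>A family with a single member already gives terms independent of the elements
    \<open>a\<close> and \<open>b\<close>.\<close>
  have "\<exists>S T. \<forall>a \<in> carrier A. \<forall>b \<in> carrier A.
      a \<oplus>\<^bsub>A\<^esub> b = eval_term A.Q (assign a b) S \<and> a \<otimes>\<^bsub>A\<^esub> b = eval_term A.Q (assign a b) T"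
    using uniform_term[where C = "\<lambda>_::unit. A" and c = "\<lambda>_. c" and N = c, OF A.circ_algebra_axioms assms(2) _ assms(4)]
    by (metis lin order_refl)
  moreover have "\<forall>a \<in> carrier A. \<forall>b \<in> carrier A. a \<oplus>\<^bsub>B\<^esub> b = a \<oplus>\<^bsub>A\<^esub> b \<and> a \<otimes>\<^bsub>B\<^esub> b = a \<otimes>\<^bsub>A\<^esub> b"
    if "anticommutative_rat_algebra B" and nilB: "nilpotent_of_class B d" and carrier: "carrier B = carrier A"
      and eq: "\<forall>a \<in> carrier A. \<forall>b \<in> carrier A. circ B k l m n f a b = circ A k l m n f a b"
    for B :: "(rat, 'a) module" and d
  proof -
    have B: "nilpotent_circ_algebra B f d"
      by (rule nilpotent_circ_algebraI) (use that assms in auto)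
    interpret B: nilpotent_circ_algebra B k l m n f d by (rule B)
    \<comment> \<open>Treating \<open>A\<close> and \<open>B\<close> as one family gives a single
      pair of terms computing the operations of both algebras, with \<open>max c d\<close> bounding
      the two classes.\<close>
    define C where "C = (\<lambda>j. if j then A else B)"
    obtain S T where ST:
      "\<And>j a b. a \<in> carrier (C j) \<Longrightarrow> b \<in> carrier (C j) \<Longrightarrow>
        a \<oplus>\<^bsub>C j\<^esub> b = eval_lin (C j) k l m n f (assign a b) S"
      "\<And>j a b. a \<in> carrier (C j) \<Longrightarrow> b \<in> carrier (C j) \<Longrightarrow>
        a \<otimes>\<^bsub>C j\<^esub> b = eval_lin (C j) k l m n f (assign a b) T"
      by (rule uniform_term[of C f "\<lambda>j. if j then c else d" "max c d" k l m n])
        (use assms(2,4) nilB A.circ_algebra_axioms B.circ_algebra_axioms in \<open>auto simp: C_def\<close>)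
    \<comment> \<open>The common operation and the scalars it determines are all that term
      evaluation uses, so the terms, and with them the operations, agree.\<close>
    have "eval_lin B k l m n f (assign a b) t = eval_lin A k l m n f (assign a b) t"
      if ab: "a \<in> carrier A" "b \<in> carrier A" for a b t
    proof (induction t)
      case (Op s t)
      then show ?case using eq lin_closed[OF ab] by simp
    next
      case (Pow t q)
      then show ?case using smult_determined_by_circ[OF A B carrier _ lin_closed[OF ab], of k l m n] eq by simp
    qed simp
    then show ?thesis using ST[of _ True] ST[of _ False] carrier by (simp add: C_def)
  qed
  ultimately show ?thesis using A.Q_uniquely_divisible A.Q_nilpotent by blast
qed

end
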